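(* There is a one-to-one correspondence between the following sets: (i) the nonnegative feasible power demands $\tilde P_c$ on the boundary of $\mathcal F$ (i.e., $\tilde P_c\in\partial\mathcal F\cap\mathcal N$); (ii) the operating points $\tilde V_L\in\partial\mathcal D$ such that $Y_{LL}\tilde V_L\le\mathcal I_L^*$; (iii) the vectors $\mu\in\mathcal M_1$ such that $Y_{LL}\mu\in\mathcal N$; (iv) the vectors $\lambda\in\Lambda_1$ such that $Y_{LL}[\lambda]\varphi(\lambda)\in\mathcal N$; (v) the vectors $\nu\in\mathcal N_1$. These correspondences satisfy the equations $$\tilde P_c=P_c(\tilde V_L),\qquad \tilde V_L=\psi(\mu)=\psi(Y_{LL}^{-1}\nu)=\varphi(\lambda)=\varphi(\chi(\nu)),$$ $$\mu\propto[\lambda]\varphi(\lambda)\propto Y_{LL}^{-1}\nu,\qquad \lambda\propto[\psi(\mu)]^{-1}\mu\propto\chi(\nu),\qquad \nu\propto Y_{LL}[\lambda]\varphi(\lambda)\propto Y_{LL}\mu,$$ where $\propto$ means equality up to a positive scaling factor. In particular, $\chi$ is, up to scaling, a one-to-one correspondence between $\mathcal N_1$ and the set in (iv). Moreover, the boundary of $\mathcal F$ in the nonnegative orthant is parametrized by $$\partial\mathcal F\cap\mathcal N=\{\,P_c(\psi(Y_{LL}^{-1}\nu))\;:\;\nu\in\mathcal N_1\,\},$$ and the corresponding operating points are parametrized by $$\{\tilde V_L\in\partial\mathcal D: P_c(\tilde V_L)\ge\mathbf 0\}=\{\,\psi(Y_{LL}^{-1}\nu)\;:\;\nu\in\mathcal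 N_1\,\}.$$
   Context: Notation: $[x]=\operatorname{diag}(x_1,\dots,x_k)$ for a vector $x$; $\mathbf 1,\mathbf 0$ are the all-ones and all-zeros vectors; vector and matrix inequalities are element-wise; $\|\cdot\|_1$ is the 1-norm. A Z-matrix is a real square matrix with nonpositive off-diagonal entries; an M-matrix is a Z-matrix all of whose eigenvalues have nonnegative real part. Setting: a DC power grid with $n\ge1$ loads and $m\ge1$ sources. Its Kirchhoff matrix $Y=\begin{pmatrix} Y_{LL} & Y_{LS} \\ Y_{SL} & Y_{SS} \end{pmatrix}\in\mathbb R^{(n+m)\times(n+m)}$ is the weighted Laplacian of a connected undirected graph with positive edge weights (symmetric, nonpositive off-diagonal entries, zero row sums), partitioned according to loads and sources, and the $n\times n$ matrix $Y_{LL}$ is irreducible; hence $Y_{LL}$ is a symmetric positive definite irreducible nonsingular M-matrix. The source voltages $V_S\in\mathbb R^m$, $V_S>\mathbf 0$, are fixed. Put $\mathcal I_L^*=-Y_{LS}V_S$ (which satisfies $\mathcal I_L^*\ge\mathbf 0$, $\mathcal I_L^*\ne\mathbf 0$) and $V_L^*=Y_{LL}^{-1}\mathcal I_L^*$ (which satisfies $V_L^*>\mathbf 0$). For $V_L\in\mathbb R^n$ put $P_c(V_L)=[V_L]Y_{LL}(V_L^*-V_L)$, with Jacobian $\frac{\partial P_c}{\partial V_L}(V_L)=[Y_{LL}(V_L^*-V_L)]-[V_L]Y_{LL}$. The set of feasible power demands is $\mathcal F=\{P_c(V_L): V_L\in\mathbb R^n,\ V_L>\mathbf 0\}$, with boundary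 $\partial\mathcal F$ in $\mathbb R^n$. $\mathcal D$ is the set of all $V_L>\mathbf 0$ such that $\frac{\partial P_c}{\partial V_L}(V_L)$ is nonsingular and its inverse has only negative entries; $\partial\mathcal D$ is its boundary in $\mathbb R^n$. $\mathcal N=\{\nu\in\mathbb R^n:\nu\ge\mathbf 0\}$ and $\mathcal N_1=\{\nu\in\mathcal N:\mathbf 1^\top\nu=1\}$. For $\mu\in\mathbb R^n$ put $g(\mu)=[\mu]Y_{LL}+[Y_{LL}\mu]$. $\mathcal M=\{\mu\in\mathbb R^n: g(\mu)\text{ is a nonsingular M-matrix}\}$, $\mathcal M_1=\{\mu\in\mathcal M:\|\mu\|_1=1\}$ (elements of $\mathcal M$ are positive vectors). For $\mu\in\mathcal M$ put $\psi(\mu)=g(\mu)^{-1}[\mu]\mathcal I_L^*$. For $\lambda\in\mathbb R^n$ put $h(\lambda)=\tfrac12([\lambda]Y_{LL}+Y_{LL}[\lambda])$. $\Lambda=\{\lambda\in\mathbb R^n: h(\lambda)\text{ is positive definite}\}$, $\Lambda_1=\{\lambda\in\Lambda:\|\lambda\|_1=1\}$ (elements of $\Lambda$ are positive vectors). For $\lambda\in\Lambda$ put $\varphi(\lambda)=\tfrac12 h(\lambda)^{-1}[\lambda]\mathcal I_L^*$. For nonzero $\nu\in\mathcal N$ (for which $Y_{LL}^{-1}\nu\in\mathcal M$) put $\chi(\nu)=[\psi(Y_{LL}^{-1}\nu)]^{-1}Y_{LL}^{-1}\nu$. *)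

theory Defs
  imports "HOL-Analysis.Analysis"
begin

section \<open>Vectors and matrices\<close>

text \<open>The strict order of type \<^typ>\<open>real^'n\<close> is not the element-wise one: \<open>x < y\<close> there
  means \<open>x \<le> y \<and> x \<noteq> y\<close>. Strict vector inequalities are therefore expressed by \<open>pos_vec\<close>,
  whereas \<open>\<le>\<close> is element-wise in the library.\<close>

definition pos_vec :: "real^'n \<Rightarrow> bool" where
  "pos_vec x \<longleftrightarrow> (\<forall>i. 0 < x $ i)"

definition diag :: "real^'n \<Rightarrow> real^'n^'n" where
  "diag x = (\<chi> i j. if i = j then x $ i else 0)"

definition norm1 :: "real^'n \<Rightarrow> real" where
  "norm1 x = (\<Sum>i\<in>UNIV. \<bar>x $ i\<bar>)"

definition pos_proportional :: "real^'n \<Rightarrow> real^'n \<Rightarrow> bool" (infix "\<propto>" 50) where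
  "x \<propto> y \<longleftrightarrow> (\<exists>c>0. x = c *\<^sub>R y)"

definition symmetric_matrix :: "real^'n^'n \<Rightarrow> bool" where
  "symmetric_matrix A \<longleftrightarrow> transpose A = A"

definition Z_matrix :: "real^'n^'n \<Rightarrow> bool" where
  "Z_matrix A \<longleftrightarrow> (\<forall>i j. i \<noteq> j \<longrightarrow> A $ i $ j \<le> 0)"

definition complex_eigenvalue :: "real^'n^'n \<Rightarrow> complex \<Rightarrow> bool" where
  "complex_eigenvalue A z \<longleftrightarrow>
     (\<exists>v::complex^'n. v \<noteq> 0 \<and> map_matrix complex_of_real A *v v = z *s v)"

definition M_matrix :: "real^'n^'n \<Rightarrow> bool" where
  "M_matrix A \<longleftrightarrow> Z_matrix A \<and> (\<forall>z. complex_eigenvalue A z \<longrightarrow> 0 \<le> Re z)"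

definition positive_definite :: "real^'n^'n \<Rightarrow> bool" where
  "positive_definite A \<longleftrightarrow> symmetric_matrix A \<and> (\<forall>x. x \<noteq> 0 \<longrightarrow> 0 < x \<bullet> (A *v x))"

text \<open>No simultaneous permutation of rows and columns brings \<open>A\<close> into block triangular form;
  every 1-by-1 matrix is irreducible.\<close>

definition irreducible_matrix :: "real^'n^'n \<Rightarrow> bool" where
  "irreducible_matrix A \<longleftrightarrow>
     (\<forall>S. S \<noteq> {} \<and> S \<noteq> UNIV \<longrightarrow> (\<exists>i\<in>S. \<exists>j\<in>-S. A $ i $ j \<noteq> 0))"


section \<open>The power grid\<close>

text \<open>Weighted Laplacians of connected undirected graphs with positive edge weights: distinct
  nodes \<open>i\<close>, \<open>j\<close> are joined by an edge of weight \<open>- Y $ i $ j\<close> iff this entry is nonzero.\<close>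

definition kirchhoff_matrix :: "real^'k^'k \<Rightarrow> bool" where
  "kirchhoff_matrix Y \<longleftrightarrow>
     symmetric_matrix Y \<and>
     (\<forall>i j. i \<noteq> j \<longrightarrow> Y $ i $ j \<le> 0) \<and>
     (\<forall>i. (\<Sum>j\<in>UNIV. Y $ i $ j) = 0) \<and>
     (\<forall>i j. (i, j) \<in> {(k, l). k \<noteq> l \<and> Y $ k $ l \<noteq> 0}\<^sup>*)"

text \<open>The nodes are indexed by \<open>'n + 'm\<close>, loads by \<open>Inl\<close> and sources by \<open>Inr\<close>.\<close>

definition block_LL :: "real^('n::finite + 'm::finite)^('n + 'm) \<Rightarrow> real^'n^'n" where
  "block_LL Y = (\<chi> i j. Y $ Inl i $ Inl j)"

definition block_LS :: "real^('n::finite + 'm::finite)^('n + 'm) \<Rightarrow> real^'m^'n" where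
  "block_LS Y = (\<chi> i j. Y $ Inl i $ Inr j)"

text \<open>Below, \<open>A\<close> stands for \<open>Y\<^sub>L\<^sub>L\<close> and \<open>b\<close> for the source-injected currents
  \<open>- Y\<^sub>L\<^sub>S V\<^sub>S\<close> at the loads.\<close>

definition V_open :: "real^'n^'n \<Rightarrow> real^'n \<Rightarrow> real^'n" where
  "V_open A b = matrix_inv A *v b"

definition P_c :: "real^'n^'n \<Rightarrow> real^'n \<Rightarrow> real^'n \<Rightarrow> real^'n" where
  "P_c A b V = diag V *v (A *v (V_open A b - V))"

definition feasible :: "real^'n^'n \<Rightarrow> real^'n \<Rightarrow> (real^'n) set" where
  "feasible A b = {P_c A b V | V. pos_vec V}"

definition D_set :: "real^'n^'n \<Rightarrow> real^'n \<Rightarrow> (real^'n) set" where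
  "D_set A b = {V. pos_vec V \<and> invertible (jacobian (P_c A b) (at V)) \<and>
                   (\<forall>i j. matrix_inv (jacobian (P_c A b) (at V)) $ i $ j < 0)}"

lemma jacobian_P_c:
  "(P_c A b has_derivative (\<lambda>h. (diag (A *v (V_open A b - V)) - diag V ** A) *v h)) (at V)"
  "jacobian (P_c A b) (at V) = diag (A *v (V_open A b - V)) - diag V ** A"
proof -
  have mv: "diag x *v y = (\<chi> i. x $ i * y $ i)" for x y :: "real^'n"
    by (simp add: diag_def matrix_vector_mult_def vec_eq_iff if_distrib[of "\<lambda>t. t * _"] cong: if_cong)
  have eq: "P_c A b = (\<lambda>V. \<chi> i. V $ i * (A *v (V_open A b - V)) $ i)"
    by (rule ext) (simp add: P_c_def mv)
  have lin: "((\<lambda>V. A *v (V_open A b - V)) has_derivative (\<lambda>h. A *v (- h))) (at V)"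
    by (rule bounded_linear.has_derivative[OF matrix_vector_mul_bounded_linear])
       (auto intro!: derivative_eq_intros)
  have lini: "((\<lambda>V. (A *v (V_open A b - V)) $ i) has_derivative (\<lambda>h. (A *v (- h)) $ i)) (at V)"
    for i by (rule bounded_linear.has_derivative[OF bounded_linear_vec_nth lin])
  have vi: "((\<lambda>V. V $ i) has_derivative (\<lambda>h. h $ i)) (at V)" for i
    by (rule bounded_linear.has_derivative[OF bounded_linear_vec_nth has_derivative_ident])
  have comp: "((\<lambda>V. V $ i * (A *v (V_open A b - V)) $ i) has_derivative
       (\<lambda>h. ((diag (A *v (V_open A b - V)) - diag V ** A) *v h) $ i)) (at V)" for i
    using has_derivative_mult[OF vi lini, of i i]
    by (rule has_derivative_eq_rhs)
       (simp add: fun_eq_iff matrix_vector_mult_diff_rdistrib mv vec.neg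
         flip: matrix_vector_mul_assoc)
  show D: "(P_c A b has_derivative
      (\<lambda>h. (diag (A *v (V_open A b - V)) - diag V ** A) *v h)) (at V)"
    unfolding eq
    by (subst has_derivative_componentwise_within)
       (auto simp: Basis_vec_def inner_axis intro: comp)
  show "jacobian (P_c A b) (at V) = diag (A *v (V_open A b - V)) - diag V ** A"
    unfolding jacobian_def frechet_derivative_at[OF D, symmetric]
    by (rule matrix_of_matrix_vector_mul)
qed


section \<open>Parametrizations\<close>

definition N_set :: "(real^'n) set" where
  "N_set = {\<nu>. 0 \<le> \<nu>}"

definition N1_set :: "(real^'n) set" where
  "N1_set = {\<nu> \<in> N_set. 1 \<bullet> \<nu> = 1}"

definition g_mat :: "real^'n^'n \<Rightarrow> real^'n \<Rightarrow> real^'n^'n" where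
  "g_mat A \<mu> = diag \<mu> ** A + diag (A *v \<mu>)"

definition M_set :: "real^'n^'n \<Rightarrow> (real^'n) set" where
  "M_set A = {\<mu>. invertible (g_mat A \<mu>) \<and> M_matrix (g_mat A \<mu>)}"

definition M1_set :: "real^'n^'n \<Rightarrow> (real^'n) set" where
  "M1_set A = {\<mu> \<in> M_set A. norm1 \<mu> = 1}"

definition psi :: "real^'n^'n \<Rightarrow> real^'n \<Rightarrow> real^'n \<Rightarrow> real^'n" where
  "psi A b \<mu> = matrix_inv (g_mat A \<mu>) *v (diag \<mu> *v b)"

definition h_mat :: "real^'n^'n \<Rightarrow> real^'n \<Rightarrow> real^'n^'n" where
  "h_mat A l = (1/2) *\<^sub>R (diag l ** A + A ** diag l)"

definition Lambda_set :: "real^'n^'n \<Rightarrow> (real^'n) set" where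
  "Lambda_set A = {l. positive_definite (h_mat A l)}"

definition Lambda1_set :: "real^'n^'n \<Rightarrow> (real^'n) set" where
  "Lambda1_set A = {l \<in> Lambda_set A. norm1 l = 1}"

definition phi :: "real^'n^'n \<Rightarrow> real^'n \<Rightarrow> real^'n \<Rightarrow> real^'n" where
  "phi A b l = (1/2) *\<^sub>R (matrix_inv (h_mat A l) *v (diag l *v b))"

definition chi :: "real^'n^'n \<Rightarrow> real^'n \<Rightarrow> real^'n \<Rightarrow> real^'n" where
  "chi A b \<nu> = matrix_inv (diag (psi A b (matrix_inv A *v \<nu>))) *v (matrix_inv A *v \<nu>)"


section \<open>The five sets in correspondence\<close>

definition boundary_demands :: "real^'n^'n \<Rightarrow> real^'n \<Rightarrow> (real^'n) set" where
  "boundary_demands A b = frontier (feasible A b) \<inter> N_set"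

definition boundary_operating_points :: "real^'n^'n \<Rightarrow> real^'n \<Rightarrow> (real^'n) set" where
  "boundary_operating_points A b = {V \<in> frontier (D_set A b). A *v V \<le> b}"

definition mu_parameters :: "real^'n^'n \<Rightarrow> (real^'n) set" where
  "mu_parameters A = {\<mu> \<in> M1_set A. A *v \<mu> \<in> N_set}"

definition lambda_parameters :: "real^'n^'n \<Rightarrow> real^'n \<Rightarrow> (real^'n) set" where
  "lambda_parameters A b = {l \<in> Lambda1_set A. A *v (diag l *v phi A b l) \<in> N_set}"

end

theory Submission
  imports Defs
begin

text \<open>Write \<open>P\<^sub>c(V) = [V](b - A V)\<close>. For \<open>V > 0\<close> the negated Jacobian is \<open>[V] S(V)\<close> with the symmetric
  irreducible Z-matrix \<open>S(V) = A - [(b - A V)/V]\<close>, so all spectral questions reduce to the smallest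
  eigenvalue of a symmetric matrix and its positive eigenvector: \<open>V \<in> \<D>\<close> iff \<open>S(V)\<close> is positive
  definite, and \<open>V = \<psi>(\<mu>)\<close> iff \<open>S(V) \<mu> = 0\<close>. The kernel of \<open>S(V)\<close> has dimension at most one, and
  \<open>A V \<le> b\<close> iff \<open>\<nu> = A \<mu> \<ge> 0\<close>. With \<open>\<lambda> = [V]\<^sup>-\<^sup>1 \<mu>\<close> one gets
  \<open>\<lambda> \<bullet> (P\<^sub>c(W) - P\<^sub>c(V)) = - (W - V) \<bullet> h(\<lambda>) (W - V)\<close>, so \<open>P\<^sub>c(V)\<close> is a boundary point of \<open>\<F>\<close>
  attained only at \<open>V\<close>. Conversely \<open>\<F>\<close> is the set of all \<open>p\<close> with \<open>p \<le> P\<^sub>c(V)\<close> for some \<open>V \<ge> 0\<close>; at a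
  maximal such \<open>V\<close> the smallest eigenvalue of \<open>S(V)\<close> is nonnegative, and it vanishes if \<open>p\<close> is a
  boundary point.\<close>

section \<open>Symmetric irreducible Z-matrices\<close>

definition irreducible_sym_Z :: "real^'n^'n \<Rightarrow> bool" where
  "irreducible_sym_Z S \<longleftrightarrow> symmetric_matrix S \<and> Z_matrix S \<and> irreducible_matrix S"

section \<open>Diagonal matrices and inner products of vectors\<close>

lemma diag_mult_nth [simp]: "(diag x *v y) $ i = x $ i * y $ i"
  by (simp add: diag_def matrix_vector_mult_def if_distrib[of "\<lambda>t. t * _"] cong: if_cong)

lemma diag_matrix_mult_nth [simp]: "(diag x ** M) $ i $ j = x $ i * M $ i $ j"
  by (simp add: diag_def matrix_matrix_mult_def if_distrib[of "\<lambda>t. t * _"] cong: if_cong)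

lemma matrix_mult_diag_nth [simp]: "(M ** diag x) $ i $ j = M $ i $ j * x $ j"
  by (simp add: diag_def matrix_matrix_mult_def if_distrib[of "\<lambda>t. _ * t"] cong: if_cong)

lemma diag_nth: "diag x $ i $ j = (if i = j then x $ i else 0)"
  by (simp add: diag_def)

lemma symmetric_matrix_inner:
  assumes "symmetric_matrix S"
  shows "x \<bullet> (S *v y) = y \<bullet> (S *v x)"
  using assms unfolding symmetric_matrix_def
  by (metis dot_lmul_matrix inner_commute transpose_matrix_vector)

lemma inner_nonneg_vec:
  fixes x y :: "real^'n"
  assumes "0 \<le> x" "0 \<le> y"
  shows "0 \<le> x \<bullet> y"
  using assms by (auto simp: inner_vec_def less_eq_vec_def intro!: sum_nonneg mult_nonneg_nonneg)

lemma inner_pos_vec: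
  fixes x y :: "real^'n"
  assumes "pos_vec x" "0 \<le> y" "y \<noteq> 0"
  shows "0 < x \<bullet> y"
proof -
  obtain i where i: "y $ i \<noteq> 0" using assms(3) by (auto simp: vec_eq_iff)
  have "0 < x $ i * y $ i"
    using assms i by (simp add: pos_vec_def less_eq_vec_def order.strict_iff_order)
  moreover have "0 \<le> x $ j * y $ j" for j
    using assms by (simp add: less_eq_vec_def pos_vec_def less_imp_le)
  ultimately show ?thesis
    unfolding inner_vec_def by (auto intro!: sum_pos2[where i = i])
qed

lemma pos_vec_nonneg: "pos_vec x \<Longrightarrow> 0 \<le> x"
  by (auto simp: pos_vec_def less_eq_vec_def less_imp_le)

lemma pos_vec_nonzero: "pos_vec x \<Longrightarrow> x \<noteq> 0"
  by (auto simp: pos_vec_def)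

section \<open>Sign arguments and Perron vectors of Z-matrices\<close>

lemma Z_matrix_nth_nonpos:
  assumes "Z_matrix S" "0 \<le> x" "x $ i = 0"
  shows "(S *v x) $ i \<le> 0"
  using assms unfolding matrix_vector_mult_def
  by (auto intro!: sum_nonpos simp: Z_matrix_def less_eq_vec_def)
     (metis mult_nonpos_nonneg mult_zero_right order_refl)

text \<open>A row of \<open>S *v x\<close> at a zero coordinate of \<open>x\<close> has only
  nonpositive terms. If there are zero coordinates, irreducibility gives one such row a negative
  term, against \<open>zero\<close>. Requiring a sign only at zero coordinates makes this usable for
  eigenvectors of any eigenvalue.\<close>

lemma irreducible_Z_pos_vec:
  assumes Z: "Z_matrix S" and irr: "irreducible_matrix S" and x: "0 \<le> x" "x \<noteq> 0"
    and zero: "\<And>i. x $ i = 0 \<Longrightarrow> 0 \<le> (S *v x) $ i"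
  shows "pos_vec x"
proof (rule ccontr)
  assume "\<not> pos_vec x"
  define I where "I = {i. x $ i = 0}"
  have xi: "0 \<le> x $ i" for i using x by (simp add: less_eq_vec_def)
  have "I \<noteq> {}" "I \<noteq> UNIV"
    using \<open>\<not> pos_vec x\<close> xi x(2)
    by (auto simp: I_def pos_vec_def vec_eq_iff not_less intro: order.antisym)
  then obtain i j where ij: "i \<in> I" "j \<notin> I" "S $ i $ j \<noteq> 0"
    using irr unfolding irreducible_matrix_def by (metis ComplD)
  have np: "S $ i $ k * x $ k \<le> 0" for k
    using Z xi[of k] ij(1) unfolding Z_matrix_def I_def
    by (cases "k = i") (auto intro: mult_nonpos_nonneg)
  have "S $ i $ j * x $ j < 0"
    using ij np[of j] by (auto simp: I_def order.strict_iff_order)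
  then have "(\<Sum>k\<in>UNIV. S $ i $ k * x $ k) < (\<Sum>k\<in>(UNIV::'a set). 0)"
    using np by (intro sum_strict_mono_ex1) auto
  then show False using zero[of i] ij(1) by (simp add: matrix_vector_mult_def I_def)
qed

text \<open>Removing signs keeps the diagonal terms and can only lower the off-diagonal ones, whose
  coefficients are nonpositive. Hence absolute values preserve minimisers of the form on the unit
  sphere.\<close>

lemma Z_matrix_abs_form:
  fixes S :: "real^'n^'n"
  assumes "Z_matrix S"
  shows "(\<chi> i. \<bar>x $ i\<bar>) \<bullet> (S *v (\<chi> i. \<bar>x $ i\<bar>)) \<le> x \<bullet> (S *v x)"
proof -
  have "\<bar>x $ i\<bar> * (S $ i $ j * \<bar>x $ j\<bar>) \<le> x $ i * (S $ i $ j * x $ j)" for i j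
  proof (cases "i = j")
    case False
    have "x $ i * x $ j \<le> \<bar>x $ i\<bar> * \<bar>x $ j\<bar>" by (metis abs_ge_self abs_mult)
    moreover have "S $ i $ j \<le> 0" using assms False by (auto simp: Z_matrix_def)
    ultimately have "S $ i $ j * (\<bar>x $ i\<bar> * \<bar>x $ j\<bar>) \<le> S $ i $ j * (x $ i * x $ j)"
      by (rule mult_left_mono_neg)
    then show ?thesis by (simp add: ac_simps)
  qed (simp add: algebra_simps)
  then show ?thesis
    by (auto simp: inner_vec_def matrix_vector_mult_def sum_distrib_left intro!: sum_mono)
qed

text \<open>Compare the form at \<open>x\<close> and at \<open>x + t (S x)\<close> for small \<open>t < 0\<close>.\<close>

lemma semidefinite_form_eq_0:
  assumes sym: "symmetric_matrix S" and psd: "\<And>y. 0 \<le> y \<bullet> (S *v y)" and "x \<bullet> (S *v x) = 0"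
  shows "S *v x = 0"
proof (rule ccontr)
  assume ne: "S *v x \<noteq> 0"
  define y where "y = S *v x"
  define a where "a = y \<bullet> y"
  define c where "c = y \<bullet> (S *v y)"
  have a: "a > 0" using ne by (simp add: a_def y_def)
  have c: "c \<ge> 0" using psd by (simp add: c_def)
  have "0 \<le> (x + t *\<^sub>R y) \<bullet> (S *v (x + t *\<^sub>R y))" for t using psd .
  moreover have "(x + t *\<^sub>R y) \<bullet> (S *v (x + t *\<^sub>R y)) = 2 * t * a + t\<^sup>2 * c" for t
    using assms(3) symmetric_matrix_inner[OF sym, of x y]
    by (simp add: matrix_vector_right_distrib matrix_vector_mult_scaleR inner_add_left inner_add_right
        a_def c_def power2_eq_square flip: y_def) (simp add: algebra_simps)
  ultimately have "0 \<le> 2 * t * a + t\<^sup>2 * c" for t by metis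
  \<comment> \<open>The quadratic in \<open>t\<close> is least at \<open>- a / c\<close>; the
    denominator \<open>c + 1\<close> also covers \<open>c = 0\<close> and still makes the value
    negative.\<close>
  from this[of "- (a / (c + 1))"] have "2 * a / (c + 1) * a \<le> (a / (c + 1))\<^sup>2 * c" by simp
  also have "\<dots> = a / (c + 1) * a * (c / (c + 1))" by (simp add: power2_eq_square)
  also have "\<dots> \<le> a / (c + 1) * a * 1" using a c by (intro mult_left_mono) auto
  finally have "2 * (a / (c + 1) * a) \<le> a / (c + 1) * a" by simp
  moreover have "0 < a / (c + 1) * a" using a c by simp
  ultimately show False by linarith
qed

text \<open>Compactness of the unit sphere yields \<open>x\<close>, and homogeneity the bound. That
  minimisers are eigenvectors comes from \<open>semidefinite_form_eq_0\<close>.\<close>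

lemma symmetric_min_eigenvalue:
  fixes S :: "real^'n^'n"
  assumes "symmetric_matrix S"
  obtains \<theta> x where "norm x = 1" "x \<bullet> (S *v x) = \<theta>" "\<And>y. \<theta> * (y \<bullet> y) \<le> y \<bullet> (S *v y)"
proof -
  let ?f = "\<lambda>y. y \<bullet> (S *v y)"
  have "continuous_on (sphere 0 1) ?f" by (intro continuous_intros)
  moreover have "sphere 0 1 \<noteq> ({} :: (real^'n) set)" by simp
  ultimately obtain x where x: "x \<in> sphere 0 1" "\<And>y. y \<in> sphere 0 1 \<Longrightarrow> ?f x \<le> ?f y"
    using continuous_attains_inf[of "sphere 0 1" ?f] by auto
  have "?f x * (y \<bullet> y) \<le> ?f y" for y
  proof (cases "y = 0")
    case False
    have "?f x \<le> ?f ((1 / norm y) *\<^sub>R y)" using False by (intro x(2)) simp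
    also have "\<dots> = ?f y / (norm y)\<^sup>2"
      by (simp only: matrix_vector_mult_scaleR inner_scaleR_left inner_scaleR_right)
        (simp add: power2_eq_square)
    finally show ?thesis using False by (simp add: field_simps power2_norm_eq_inner)
  qed simp
  then show ?thesis using that x(1) by auto
qed

lemma irreducible_sym_Z_add_diag:
  assumes "irreducible_sym_Z S"
  shows "irreducible_sym_Z (S + diag d)"
proof -
  have "(S + diag d) $ i $ j = S $ i $ j" if "i \<noteq> j" for i j
    using that by (simp add: diag_nth)
  moreover have "transpose (S + diag d) = transpose S + diag d"
    by (simp add: transpose_def vec_eq_iff diag_nth)
  ultimately show ?thesis
    using assms unfolding irreducible_sym_Z_def symmetric_matrix_def Z_matrix_def irreducible_matrix_def
    by (metis ComplD)
qed

text \<open>\<open>\<theta>\<close> is the minimum of the Rayleigh quotient. After the shift to the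
  semidefinite \<open>T\<close>, the absolute value of a minimiser has form value 0, so it is an
  eigenvector; irreducibility makes it positive.\<close>

lemma perron_sym_Z:
  fixes S :: "real^'n^'n"
  assumes "irreducible_sym_Z S"
  obtains \<theta> x where "pos_vec x" "S *v x = \<theta> *\<^sub>R x" "\<And>y. \<theta> * (y \<bullet> y) \<le> y \<bullet> (S *v y)"
proof -
  have sym: "symmetric_matrix S" and Z: "Z_matrix S" and irr: "irreducible_matrix S"
    using assms by (auto simp: irreducible_sym_Z_def)
  obtain \<theta> x where x: "norm x = 1" "x \<bullet> (S *v x) = \<theta>" and min: "\<And>y. \<theta> * (y \<bullet> y) \<le> y \<bullet> (S *v y)"
    using symmetric_min_eigenvalue[OF sym] by metis
  define T where "T = S + diag (\<chi> i. - \<theta>)"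
  have T: "T *v y = S *v y - \<theta> *\<^sub>R y" for y
    by (simp add: T_def matrix_vector_mult_add_rdistrib vec_eq_iff)
  have "irreducible_sym_Z T" unfolding T_def by (rule irreducible_sym_Z_add_diag[OF assms])
  then have symT: "symmetric_matrix T" by (simp add: irreducible_sym_Z_def)
  define a where "a = (\<chi> i. \<bar>x $ i\<bar>)"
  have aa: "a \<bullet> a = 1"
    using x(1) by (simp add: a_def norm_eq_1 inner_vec_def)
  have "a \<bullet> (S *v a) \<le> \<theta>"
    using Z_matrix_abs_form[OF Z, of x] x(2) by (simp add: a_def)
  then have "a \<bullet> (T *v a) = 0"
    using min[of a] aa by (simp add: T inner_diff_right)
  moreover have "0 \<le> y \<bullet> (T *v y)" for y
    using min[of y] by (simp add: T inner_diff_right)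
  ultimately have "T *v a = 0" using semidefinite_form_eq_0[OF symT] by blast
  then have eig: "S *v a = \<theta> *\<^sub>R a" by (simp add: T)
  have "pos_vec a"
  proof (rule irreducible_Z_pos_vec[OF Z irr])
    show "0 \<le> a" by (simp add: a_def less_eq_vec_def)
    show "a \<noteq> 0" using aa by auto
  qed (simp add: eig)
  then show ?thesis using that eig min by blast
qed

text \<open>Pairing \<open>S *v x\<close> with the positive eigenvector \<open>y\<close> gives
  \<open>\<theta> * (x \<bullet> y) > 0\<close>, so the smallest eigenvalue is positive.\<close>

lemma positive_definiteI_pos_vec:
  assumes S: "irreducible_sym_Z S" and x: "pos_vec x" "0 \<le> S *v x" "S *v x \<noteq> 0"
  shows "positive_definite S"
proof -
  obtain \<theta> y where y: "pos_vec y" "S *v y = \<theta> *\<^sub>R y" and min: "\<And>z. \<theta> * (z \<bullet> z) \<le> z \<bullet> (S *v z)"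
    using perron_sym_Z[OF S] by metis
  have sym: "symmetric_matrix S" using S by (simp add: irreducible_sym_Z_def)
  have "0 < y \<bullet> (S *v x)" using inner_pos_vec y(1) x by blast
  also have "\<dots> = \<theta> * (x \<bullet> y)" using symmetric_matrix_inner[OF sym, of x y] y(2) by simp
  finally have "0 < \<theta>"
    using inner_nonneg_vec[of x y] x(1) y(1)
    by (metis mult_nonpos_nonneg not_less pos_vec_nonneg)
  then have "z \<noteq> 0 \<Longrightarrow> 0 < z \<bullet> (S *v z)" for z
    using min[of z] by (smt (verit) inner_gt_zero_iff mult_pos_pos)
  then show ?thesis using sym by (simp add: positive_definite_def)
qed

text \<open>The Perron vector serves. Together with \<open>positive_definiteI_pos_vec\<close> this
  turns positive definiteness into the existence of a positive test vector, as
  \<open>open_D_set\<close> needs.\<close>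

lemma positive_definite_pos_vec:
  assumes S: "irreducible_sym_Z S" and "positive_definite S"
  obtains x where "pos_vec x" "pos_vec (S *v x)"
proof -
  obtain \<theta> x where x: "pos_vec x" "S *v x = \<theta> *\<^sub>R x" using perron_sym_Z[OF S] by metis
  have "0 < x \<bullet> (S *v x)" using assms(2) pos_vec_nonzero[OF x(1)] by (auto simp: positive_definite_def)
  then have "0 < \<theta>" using x(2) inner_ge_zero[of x] by (auto simp: zero_less_mult_iff)
  then show ?thesis using that x by (auto simp: pos_vec_def)
qed

text \<open>Subtract from \<open>y\<close> the largest multiple of \<open>x\<close> lying below it.
  The remainder is a nonnegative kernel vector with a zero coordinate, so it vanishes by
  irreducibility.\<close>

lemma null_space_dim_1:
  assumes S: "irreducible_sym_Z S" and x: "pos_vec x" "S *v x = 0" and y: "S *v y = 0"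
  obtains c where "y = c *\<^sub>R x"
proof -
  have Z: "Z_matrix S" and irr: "irreducible_matrix S"
    using S by (auto simp: irreducible_sym_Z_def)
  define c where "c = (MIN i. y $ i / x $ i)"
  define z where "z = y - c *\<^sub>R x"
  have "c \<in> range (\<lambda>i. y $ i / x $ i)" unfolding c_def by (intro Min_in) auto
  then obtain k where k: "c = y $ k / x $ k" by auto
  have "c \<le> y $ i / x $ i" for i unfolding c_def by (intro Min_le) auto
  then have "0 \<le> z"
    using x(1) by (auto simp: z_def less_eq_vec_def pos_vec_def field_simps)
  moreover have "S *v z = 0"
    by (simp add: z_def matrix_vector_mult_diff_distrib matrix_vector_mult_scaleR x(2) y)
  moreover have "z $ k = 0" using x(1) by (simp add: z_def k pos_vec_def less_imp_neq[symmetric])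
  ultimately have "z = 0"
    using irreducible_Z_pos_vec[OF Z irr, of z] by (metis less_irrefl order_refl pos_vec_def zero_index)
  then have "y = c *\<^sub>R x" by (simp add: z_def)
  then show ?thesis by (rule that)
qed

text \<open>Test with the negative part \<open>n\<close>: the supports of \<open>n\<close> and
  \<open>p\<close> are disjoint, so only off-diagonal, nonpositive terms remain in
  \<open>n \<bullet> (S *v p)\<close>; hence \<open>n \<bullet> (S *v n) \<le> 0\<close> and
  \<open>n = 0\<close>.\<close>

lemma positive_definite_Z_nonneg:
  fixes S :: "real^'n^'n"
  assumes pd: "positive_definite S" and Z: "Z_matrix S" and x: "0 \<le> S *v x"
  shows "0 \<le> x"
proof -
  define p where "p = (\<chi> i. max (x $ i) 0)"
  define n where "n = (\<chi> i. max (- x $ i) 0)"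
  have xp: "x = p - n" by (simp add: p_def n_def vec_eq_iff max_def)
  have "n $ i * (S $ i $ j * p $ j) \<le> 0" for i j
  proof (cases "i = j")
    case False
    then have "S $ i $ j \<le> 0" using Z by (auto simp: Z_matrix_def)
    moreover have "0 \<le> n $ i" "0 \<le> p $ j" by (auto simp: n_def p_def)
    ultimately show ?thesis by (meson mult_nonneg_nonpos mult_nonpos_nonneg)
  qed (auto simp: n_def p_def max_def)
  then have "n \<bullet> (S *v p) \<le> 0"
    by (auto simp: inner_vec_def matrix_vector_mult_def sum_distrib_left intro!: sum_nonpos)
  moreover have "0 \<le> n \<bullet> (S *v x)"
    by (intro inner_nonneg_vec x) (simp add: n_def less_eq_vec_def)
  ultimately have "n \<bullet> (S *v n) \<le> 0"
    by (simp add: xp matrix_vector_mult_diff_distrib inner_diff_right)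
  then have "n = 0" using pd unfolding positive_definite_def by (metis not_less)
  then have "x = p" using xp by simp
  moreover have "0 \<le> p" by (simp add: p_def less_eq_vec_def)
  ultimately show ?thesis by simp
qed

lemma positive_definite_Z_pos:
  assumes S: "irreducible_sym_Z S" and pd: "positive_definite S" and x: "0 \<le> S *v x" "x \<noteq> 0"
  shows "pos_vec x"
proof (rule irreducible_Z_pos_vec[of S])
  show Z: "Z_matrix S" and "irreducible_matrix S" using S by (simp_all add: irreducible_sym_Z_def)
  show "0 \<le> x" by (rule positive_definite_Z_nonneg[OF pd Z x(1)])
  show "x \<noteq> 0" by (rule x(2))
  show "0 \<le> (S *v x) $ i" for i using x(1) by (simp add: less_eq_vec_def)
qed

section \<open>Inverses and products with diagonal matrices\<close>

lemma positive_definite_invertible: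
  fixes S :: "real^'n^'n"
  assumes "positive_definite S"
  shows "invertible S"
proof -
  have "x = 0" if "S *v x = 0" for x
    using assms that by (metis inner_zero_right less_irrefl positive_definite_def)
  then show ?thesis by (simp add: invertible_left_inverse matrix_left_invertible_ker)
qed

lemma invertible_diag_mult:
  fixes S :: "real^'n^'n"
  assumes "pos_vec d" "invertible S"
  shows "invertible (diag d ** S)"
proof (rule invertible_mult[OF _ assms(2)])
  have "diag d ** diag (\<chi> i. 1 / d $ i) = mat 1" "diag (\<chi> i. 1 / d $ i) ** diag d = mat 1"
    using assms(1) by (auto simp: vec_eq_iff mat_def diag_nth pos_vec_def less_imp_neq[symmetric])
  then show "invertible (diag d)" unfolding invertible_def by blast
qed

lemma matrix_inv_mult_eq_iff:
  fixes S :: "real^'n^'n"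
  assumes "invertible S"
  shows "matrix_inv S *v x = y \<longleftrightarrow> S *v y = x"
proof -
  have "matrix_inv S ** S = mat 1" "S ** matrix_inv S = mat 1"
    using assms by (auto simp: invertible_def matrix_inv_def intro: someI2_ex)
  then have "matrix_inv S *v (S *v z) = z" "S *v (matrix_inv S *v z) = z" for z
    by (simp_all add: matrix_vector_mul_assoc)
  then show ?thesis by metis
qed

lemma matrix_inv_diag_mult_nth:
  assumes "pos_vec d"
  shows "(matrix_inv (diag d) *v x) $ i = x $ i / d $ i"
proof -
  have "invertible (mat 1 :: real^'a^'a)" by (auto simp: invertible_def)
  then have "invertible (diag d)" using invertible_diag_mult[OF assms, of "mat 1"] by simp
  then have "matrix_inv (diag d) *v x = (\<chi> i. x $ i / d $ i)"
    using assms by (subst matrix_inv_mult_eq_iff) (auto simp: vec_eq_iff pos_vec_def less_imp_neq[symmetric])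
  then show ?thesis by simp
qed

text \<open>An eigenvector \<open>v\<close> satisfies T v = z [d]^-1 v. Pairing with its conjugate
  expresses \<open>Re z\<close> as a quotient of two positive forms in the real part
  \<open>p\<close> and the imaginary part \<open>q\<close>.\<close>

lemma M_matrix_diag_mult:
  fixes T :: "real^'n^'n"
  assumes d: "pos_vec d" and T: "positive_definite T" and Z: "Z_matrix T"
  shows "M_matrix (diag d ** T)"
  unfolding M_matrix_def
proof (intro conjI allI impI)
  have d0: "0 < d $ i" for i using d by (simp add: pos_vec_def)
  show "Z_matrix (diag d ** T)"
    using Z d0 by (auto simp: Z_matrix_def mult_nonneg_nonpos less_imp_le)
  fix z assume "complex_eigenvalue (diag d ** T) z"
  then obtain v :: "complex^'n" where v: "v \<noteq> 0"
      and eig: "map_matrix complex_of_real (diag d ** T) *v v = z *s v"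
    by (auto simp: complex_eigenvalue_def)
  define p q :: "real^'n" where "p = (\<chi> i. Re (v $ i))" and "q = (\<chi> i. Im (v $ i))"
  have eig_i: "(\<Sum>j\<in>UNIV. complex_of_real (d $ i * T $ i $ j) * v $ j) = z * v $ i" for i
    using arg_cong[OF eig, of "\<lambda>w. w $ i"]
    by (simp add: matrix_vector_mult_def map_matrix_def)
  have "d $ i * (T *v p) $ i = Re z * p $ i - Im z * q $ i" for i
    using arg_cong[OF eig_i[of i], of Re]
    by (simp add: matrix_vector_mult_def p_def q_def sum_distrib_left ac_simps)
  then have Tp: "(T *v p) $ i = (Re z * p $ i - Im z * q $ i) / d $ i" for i
    using d0[of i] by (simp add: field_simps)
  have "d $ i * (T *v q) $ i = Re z * q $ i + Im z * p $ i" for i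
    using arg_cong[OF eig_i[of i], of Im]
    by (simp add: matrix_vector_mult_def p_def q_def sum_distrib_left ac_simps)
  then have Tq: "(T *v q) $ i = (Re z * q $ i + Im z * p $ i) / d $ i" for i
    using d0[of i] by (simp add: field_simps)
  \<comment> \<open>The terms with \<open>Im z\<close> coming from \<open>Tp\<close> and
    \<open>Tq\<close> cancel.\<close>
  have "p \<bullet> (T *v p) + q \<bullet> (T *v q) = (\<Sum>i\<in>UNIV. Re z * ((p $ i)\<^sup>2 + (q $ i)\<^sup>2) / d $ i)"
    unfolding inner_vec_def sum.distrib[symmetric]
    by (intro sum.cong refl) (simp add: Tp Tq power2_eq_square add_divide_distrib[symmetric] algebra_simps
        flip: add_divide_distrib)
  also have "\<dots> = Re z * (\<Sum>i\<in>UNIV. ((p $ i)\<^sup>2 + (q $ i)\<^sup>2) / d $ i)"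
    by (simp add: sum_distrib_left)
  finally have eq: "p \<bullet> (T *v p) + q \<bullet> (T *v q) = Re z * (\<Sum>i\<in>UNIV. ((p $ i)\<^sup>2 + (q $ i)\<^sup>2) / d $ i)" .
  have psd: "0 \<le> x \<bullet> (T *v x)" for x
    using T by (cases "x = 0") (auto simp: positive_definite_def less_imp_le)
  have pos: "x \<noteq> 0 \<Longrightarrow> 0 < x \<bullet> (T *v x)" for x
    using T by (auto simp: positive_definite_def)
  have "p \<noteq> 0 \<or> q \<noteq> 0" using v by (auto simp: p_def q_def vec_eq_iff complex_eq_iff)
  then have "0 < p \<bullet> (T *v p) + q \<bullet> (T *v q)"
    using psd pos by (metis add_nonneg_pos add_pos_nonneg)
  moreover have "0 \<le> (\<Sum>i\<in>UNIV. ((p $ i)\<^sup>2 + (q $ i)\<^sup>2) / d $ i)"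
    using d0 by (intro sum_nonneg) (simp add: less_imp_le)
  ultimately show "0 \<le> Re z" using eq by (simp add: zero_less_mult_iff)
qed

lemma inner_diag_nonneg:
  fixes d x :: "real^'n"
  assumes "0 \<le> d"
  shows "0 \<le> x \<bullet> (diag d *v x)"
proof -
  have "0 \<le> x $ i * (d $ i * x $ i)" for i
    using assms mult_nonneg_nonneg[of "d $ i" "x $ i * x $ i"] by (simp add: less_eq_vec_def ac_simps)
  then show ?thesis by (simp add: inner_vec_def sum_nonneg)
qed

lemma positive_definite_nth_pos:
  fixes S :: "real^'n^'n"
  assumes "positive_definite S"
  shows "0 < S $ i $ i"
proof -
  have "0 < axis i 1 \<bullet> (S *v axis i 1)"
    using assms by (simp add: positive_definite_def axis_eq_0_iff)
  then show ?thesis by (simp add: inner_axis' matrix_vector_mult_basis column_def)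
qed

section \<open>Normalization in the 1-norm and proportionality\<close>

definition normalize1 :: "real^'n \<Rightarrow> real^'n" where
  "normalize1 x = (1 / norm1 x) *\<^sub>R x"

lemma norm1_scaleR: "norm1 (c *\<^sub>R x) = \<bar>c\<bar> * norm1 x"
  by (simp add: norm1_def abs_mult sum_distrib_left)

lemma norm1_pos: "pos_vec x \<Longrightarrow> 0 < norm1 x"
  by (auto simp: norm1_def pos_vec_def intro!: sum_pos) (metis less_irrefl)

lemma norm1_normalize1: "pos_vec x \<Longrightarrow> norm1 (normalize1 x) = 1"
  using norm1_pos[of x] by (simp add: normalize1_def norm1_scaleR)

lemma normalize1_scaleR:
  assumes "0 < c"
  shows "normalize1 (c *\<^sub>R x) = normalize1 x"
  using assms by (simp add: normalize1_def norm1_scaleR)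

lemma normalize1_norm1_1: "norm1 x = 1 \<Longrightarrow> normalize1 x = x"
  by (simp add: normalize1_def)

lemma normalize1_scales:
  assumes "pos_vec x"
  obtains c where "0 < c" "normalize1 x = c *\<^sub>R x"
  using that[of "1 / norm1 x"] norm1_pos[OF assms] by (simp add: normalize1_def)

lemma pos_proportionalI:
  assumes "x = c *\<^sub>R z" "y = d *\<^sub>R z" "0 < c" "0 < d"
  shows "x \<propto> y"
  unfolding pos_proportional_def using assms by (intro exI[of _ "c / d"]) simp

lemma bij_betw_image:
  assumes "bij_betw (\<lambda>x. p (f x)) N X"
  shows "bij_betw p (f ` N) X"
  using assms unfolding bij_betw_def by (auto simp: inj_on_def image_image)

lemma diag_scaleR_mult: "diag (c *\<^sub>R l) *v x = c *\<^sub>R (diag l *v x)"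
  by (simp add: vec_eq_iff)


section \<open>Load networks\<close>

text \<open>All that the argument needs of the grid; \<open>kirchhoff_load_network\<close> supplies
  it.\<close>

locale load_network =
  fixes A :: "real^'n^'n" and b :: "real^'n"
  assumes A_irr: "irreducible_sym_Z A" and A_pd: "positive_definite A"
    and b_nonneg: "0 \<le> b" and b_nonzero: "b \<noteq> 0"
begin

lemma A_sym: "symmetric_matrix A" and A_Z: "Z_matrix A" and A_irreducible: "irreducible_matrix A"
  using A_irr by (simp_all add: irreducible_sym_Z_def)

lemma A_inv_eq_iff: "matrix_inv A *v x = y \<longleftrightarrow> A *v y = x"
  by (rule matrix_inv_mult_eq_iff[OF positive_definite_invertible[OF A_pd]])

lemma A_inv: "A *v (matrix_inv A *v x) = x"
  using A_inv_eq_iff by blast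

lemma P_c_nth: "P_c A b V $ i = V $ i * (b $ i - (A *v V) $ i)"
  by (simp add: P_c_def V_open_def matrix_vector_mult_diff_distrib A_inv right_diff_distrib)

text \<open>Factoring \<open>[V]\<close> out of the negated Jacobian of \<open>P_c\<close> leaves a symmetric matrix.\<close>

definition sym_jac :: "real^'n \<Rightarrow> real^'n^'n" where
  "sym_jac V = A + diag (\<chi> i. ((A *v V) $ i - b $ i) / V $ i)"

lemma sym_jac_mult_nth:
  assumes "pos_vec V"
  shows "V $ i * (sym_jac V *v x) $ i = V $ i * (A *v x) $ i + ((A *v V) $ i - b $ i) * x $ i"
  using assms by (simp add: sym_jac_def matrix_vector_mult_add_rdistrib pos_vec_def
      less_imp_neq[symmetric] distrib_left)

lemma sym_jac_irr: "irreducible_sym_Z (sym_jac V)"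
  unfolding sym_jac_def by (rule irreducible_sym_Z_add_diag[OF A_irr])

lemma jacobian_eq:
  assumes "pos_vec V"
  shows "jacobian (P_c A b) (at V) = - (diag V ** sym_jac V)"
  using assms unfolding jacobian_P_c
  by (simp add: vec_eq_iff sym_jac_def V_open_def matrix_vector_mult_diff_distrib diag_nth pos_vec_def
      less_imp_neq[symmetric] A_inv distrib_left)

text \<open>\<open>P_c\<close> is quadratic, so its second-order expansion is exact; the linear part
  is the Jacobian, factored through \<open>sym_jac\<close>. It governs small moves along a Perron
  vector.\<close>

lemma P_c_add_scaled_nth:
  assumes "pos_vec V"
  shows "P_c A b (V + t *\<^sub>R x) $ i =
    P_c A b V $ i - t * (V $ i * (sym_jac V *v x) $ i + t * (x $ i * (A *v x) $ i))"
  unfolding sym_jac_mult_nth[OF assms] P_c_nth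
  by (simp add: matrix_vector_right_distrib matrix_vector_mult_scaleR algebra_simps)

text \<open>Clearing denominators turns the kernel equation into the one that determines
  \<open>psi\<close> in \<open>psi_eq_iff\<close>.\<close>

lemma sym_jac_eq_0_iff:
  assumes "pos_vec V"
  shows "sym_jac V *v x = 0 \<longleftrightarrow> (\<forall>i. x $ i * (b $ i - (A *v V) $ i) = V $ i * (A *v x) $ i)"
proof -
  have "sym_jac V *v x = 0 \<longleftrightarrow> (\<forall>i. V $ i * (sym_jac V *v x) $ i = 0)"
    using assms by (auto simp: vec_eq_iff pos_vec_def less_imp_neq[symmetric])
  then show ?thesis
    unfolding sym_jac_mult_nth[OF assms] by (auto simp: algebra_simps)
qed

text \<open>By \<open>jacobian_eq\<close>, negativity of the inverse Jacobian is inverse-positivity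
  of \<open>sym_jac V\<close>, which for an irreducible symmetric Z-matrix amounts to positive
  definiteness.\<close>

lemma mem_D_set_iff: "V \<in> D_set A b \<longleftrightarrow> pos_vec V \<and> positive_definite (sym_jac V)"
proof (cases "pos_vec V")
  case True
  let ?S = "sym_jac V"
  let ?J = "jacobian (P_c A b) (at V)"
  have V0: "0 < V $ i" for i using True by (simp add: pos_vec_def)
  have Jx: "(?J *v x) $ i = - (V $ i * (?S *v x) $ i)" for x i
  proof -
    have "?J *v x = - ((diag V ** ?S) *v x)"
      using matrix_vector_mult_diff_rdistrib[of 0 "diag V ** ?S" x] by (simp add: jacobian_eq[OF True])
    then show ?thesis by (simp flip: matrix_vector_mul_assoc)
  qed
  have "invertible ?J \<and> (\<forall>i j. matrix_inv ?J $ i $ j < 0)" if pd: "positive_definite ?S"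
  proof -
    have "x = 0" if "?J *v x = 0" for x
    proof -
      have "?S *v x = 0"
        using Jx[of x] V0 that by (simp add: vec_eq_iff less_imp_neq[symmetric])
      then show ?thesis
        using matrix_inv_mult_eq_iff[OF positive_definite_invertible[OF pd]]
        by (metis matrix_vector_mult_0_right)
    qed
    then have inv: "invertible ?J"
      by (simp add: invertible_left_inverse matrix_left_invertible_ker)
    moreover have "matrix_inv ?J $ i $ j < 0" for i j
    proof -
      \<comment> \<open>Column \<open>j\<close> of the inverse. \<open>?S *v (- x)\<close> is a unit
        vector divided entrywise by \<open>V\<close>, so \<open>- x\<close> is positive.\<close>
      define x where "x = matrix_inv ?J *v axis j 1"
      have "?J *v x = axis j 1" using matrix_inv_mult_eq_iff[OF inv] x_def by blast
      then have SJ: "V $ i * (?S *v (- x)) $ i = axis j 1 $ i" for i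
        using Jx[of x i] matrix_vector_mult_diff_distrib[of ?S 0 x] by simp
      have "(?S *v (- x)) $ i = axis j 1 $ i / V $ i" for i
        using SJ[of i] V0[of i] by (simp add: field_simps)
      then have "0 \<le> ?S *v (- x)"
        using V0 by (simp add: less_eq_vec_def axis_def less_imp_le)
      moreover have "- x \<noteq> 0" using SJ[of j] by auto
      ultimately have "pos_vec (- x)"
        using positive_definite_Z_pos[OF sym_jac_irr pd] by blast
      then show ?thesis
        by (simp add: pos_vec_def x_def matrix_vector_mult_basis column_def)
    qed
    ultimately show ?thesis by blast
  qed
  moreover have "positive_definite ?S" if inv: "invertible ?J" and neg: "\<forall>i j. matrix_inv ?J $ i $ j < 0"
  proof -
    \<comment> \<open>Negative entries of the inverse make \<open>x\<close> positive, and
      \<open>?J *v x = - 1\<close> makes \<open>?S *v x\<close> positive: a test vector for positive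
      definiteness.\<close>
    define x where "x = matrix_inv ?J *v (- 1)"
    have "x $ i = (\<Sum>j\<in>UNIV. - (matrix_inv ?J $ i $ j))" for i
      by (simp add: x_def matrix_vector_mult_def)
    then have "pos_vec x" using neg by (auto simp: pos_vec_def intro!: sum_pos)
    moreover have "?J *v x = - 1" using matrix_inv_mult_eq_iff[OF inv] x_def by blast
    then have "V $ i * (?S *v x) $ i = 1" for i using Jx[of x i] by simp
    then have "pos_vec (?S *v x)"
      using V0 by (metis pos_vec_def zero_less_mult_pos zero_less_one)
    ultimately show ?thesis
      using positive_definiteI_pos_vec[OF sym_jac_irr] pos_vec_nonneg pos_vec_nonzero by blast
  qed
  ultimately show ?thesis using True by (auto simp: D_set_def)
qed (simp add: D_set_def)

text \<open>For a fixed positive \<open>x\<close>, positivity of \<open>sym_jac V *v x\<close>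
  becomes, after multiplication by \<open>V\<close>, finitely many strict inequalities continuous in
  \<open>V\<close>. \<open>D_set\<close> is the union of these open sets over all test vectors
  \<open>x\<close>.\<close>

lemma open_D_set: "open (D_set A b)"
proof -
  have "D_set A b = (\<Union>x\<in>{x. pos_vec x}. {V. \<forall>i. 0 < V $ i \<and>
      0 < V $ i * (A *v x) $ i + ((A *v V) $ i - b $ i) * x $ i})" (is "_ = ?U")
  proof (intro set_eqI iffI)
    fix V assume "V \<in> D_set A b"
    then have V: "pos_vec V" "positive_definite (sym_jac V)" by (auto simp: mem_D_set_iff)
    obtain x where x: "pos_vec x" "pos_vec (sym_jac V *v x)"
      using positive_definite_pos_vec[OF sym_jac_irr V(2)] .
    have "0 < V $ i * (sym_jac V *v x) $ i" for i
      using V(1) x(2) by (simp add: pos_vec_def)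
    then show "V \<in> ?U" using x(1) V(1) unfolding sym_jac_mult_nth[OF V(1)] by (auto simp: pos_vec_def)
  next
    fix V assume "V \<in> ?U"
    then obtain x where x: "pos_vec x" and V: "pos_vec V"
      and "0 < V $ i * (A *v x) $ i + ((A *v V) $ i - b $ i) * x $ i" for i
      by (auto simp: pos_vec_def)
    then have "0 < V $ i * (sym_jac V *v x) $ i" for i using sym_jac_mult_nth[OF V] by simp
    then have "pos_vec (sym_jac V *v x)"
      using V by (metis pos_vec_def zero_less_mult_pos)
    then have "positive_definite (sym_jac V)"
      using positive_definiteI_pos_vec[OF sym_jac_irr x] pos_vec_nonneg pos_vec_nonzero by blast
    then show "V \<in> D_set A b" using V by (simp add: mem_D_set_iff)
  qed
  moreover have "open ?U"
    unfolding Collect_all_eq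
    by (intro open_UN ballI open_INT finite open_Collect_conj open_Collect_less continuous_intros)
  ultimately show ?thesis by simp
qed

subsection \<open>Parametrizations\<close>

lemma A_pos_vec:
  assumes "0 \<le> A *v \<mu>" "\<mu> \<noteq> 0"
  shows "pos_vec \<mu>"
  by (rule positive_definite_Z_pos[OF A_irr A_pd assms])

lemma g_mat_mult_nth: "(g_mat A \<mu> *v x) $ i = \<mu> $ i * (A *v x) $ i + (A *v \<mu>) $ i * x $ i"
  by (simp add: g_mat_def matrix_vector_mult_add_rdistrib flip: matrix_vector_mul_assoc)

text \<open>As with the Jacobian, the remaining factor is symmetric, so
  \<open>M_matrix_diag_mult\<close> applies once it is positive definite.\<close>

lemma g_mat_factor:
  assumes "pos_vec \<mu>"
  shows "g_mat A \<mu> = diag \<mu> ** (A + diag (\<chi> i. (A *v \<mu>) $ i / \<mu> $ i))"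
  using assms by (simp add: g_mat_def vec_eq_iff diag_nth pos_vec_def less_imp_neq[symmetric] distrib_left)

lemma g_mat_factor_pd:
  assumes "0 \<le> A *v \<mu>" "\<mu> \<noteq> 0"
  shows "positive_definite (A + diag (\<chi> i. (A *v \<mu>) $ i / \<mu> $ i))"
proof -
  have "pos_vec \<mu>" using A_pos_vec assms .
  then have "0 \<le> (\<chi> i. (A *v \<mu>) $ i / \<mu> $ i)"
    using assms(1) by (simp add: less_eq_vec_def pos_vec_def less_imp_le)
  then show ?thesis
    using A_pd inner_diag_nonneg irreducible_sym_Z_add_diag[OF A_irr]
    unfolding positive_definite_def irreducible_sym_Z_def matrix_vector_mult_add_rdistrib inner_add_right
    by (meson add_pos_nonneg)
qed

text \<open>Membership in \<open>M_set\<close> is thus automatic for the vectors of set (iii):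
  adding a nonnegative diagonal to \<open>A\<close> keeps it positive definite.\<close>

lemma M_setI:
  assumes "0 \<le> A *v \<mu>" "\<mu> \<noteq> 0"
  shows "\<mu> \<in> M_set A"
proof -
  have \<mu>: "pos_vec \<mu>" using A_pos_vec assms .
  have "Z_matrix (A + diag d)" for d
    using irreducible_sym_Z_add_diag[OF A_irr] by (simp add: irreducible_sym_Z_def)
  then show ?thesis
    using g_mat_factor_pd[OF assms] \<mu> unfolding M_set_def mem_Collect_eq g_mat_factor[OF \<mu>]
    by (blast intro: invertible_diag_mult positive_definite_invertible M_matrix_diag_mult)
qed

lemma psi_eq_iff:
  assumes "0 \<le> A *v \<mu>" "\<mu> \<noteq> 0"
  shows "psi A b \<mu> = V \<longleftrightarrow> (\<forall>i. \<mu> $ i * (b $ i - (A *v V) $ i) = V $ i * (A *v \<mu>) $ i)"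
proof -
  have "invertible (g_mat A \<mu>)" using M_setI[OF assms] by (simp add: M_set_def)
  then show ?thesis
    unfolding psi_def by (subst matrix_inv_mult_eq_iff) (auto simp: vec_eq_iff g_mat_mult_nth algebra_simps)
qed

text \<open>The hub of the correspondence: a positive operating point with singular Jacobian, paired
  with a positive kernel vector. A positive kernel vector belongs to the smallest eigenvalue of
  \<open>sym_jac V\<close>, which is therefore 0.\<close>

definition critical :: "real^'n \<Rightarrow> real^'n \<Rightarrow> bool" where
  "critical V \<mu> \<longleftrightarrow> pos_vec V \<and> pos_vec \<mu> \<and> sym_jac V *v \<mu> = 0"

lemma critical_eq:
  "critical V \<mu> \<Longrightarrow> \<mu> $ i * (b $ i - (A *v V) $ i) = V $ i * (A *v \<mu>) $ i"
  using sym_jac_eq_0_iff[of V \<mu>] by (simp add: critical_def)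

text \<open>Both sides of \<open>critical_eq\<close> carry positive factors, so their signs agree.
  This links the side condition of (ii) with those of (iii) and (iv).\<close>

lemma critical_nonneg_iff:
  assumes "critical V \<mu>"
  shows "0 \<le> A *v \<mu> \<longleftrightarrow> A *v V \<le> b"
proof -
  have "0 < V $ i" "0 < \<mu> $ i" for i using assms by (auto simp: critical_def pos_vec_def)
  then have "0 \<le> (A *v \<mu>) $ i \<longleftrightarrow> 0 \<le> b $ i - (A *v V) $ i" for i
    using critical_eq[OF assms, of i] mult_le_cancel_left_pos[of "\<mu> $ i" 0 "b $ i - (A *v V) $ i"]
      mult_le_cancel_left_pos[of "V $ i" 0 "(A *v \<mu>) $ i"] by simp
  then show ?thesis by (simp add: less_eq_vec_def)
qed

text \<open>Dividing the equation of \<open>psi\<close> by \<open>\<mu>\<close> gives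
  \<open>?T *v ?V = b\<close> with a positive definite irreducible Z-matrix \<open>?T\<close>; since
  \<open>b\<close> is nonnegative and nonzero, \<open>?V\<close> is positive.\<close>

lemma critical_psi:
  assumes "0 \<le> A *v \<mu>" "\<mu> \<noteq> 0"
  shows "critical (psi A b \<mu>) \<mu>"
proof -
  let ?V = "psi A b \<mu>"
  let ?T = "A + diag (\<chi> i. (A *v \<mu>) $ i / \<mu> $ i)"
  have \<mu>: "pos_vec \<mu>" using A_pos_vec assms .
  have eq: "\<mu> $ i * (b $ i - (A *v ?V) $ i) = ?V $ i * (A *v \<mu>) $ i" for i
    using psi_eq_iff[OF assms] by blast
  have "(?T *v ?V) $ i = b $ i" for i
    using eq[of i] \<mu> by (simp add: matrix_vector_mult_add_rdistrib pos_vec_def less_imp_neq[symmetric] field_simps)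
  then have T: "?T *v ?V = b" by (simp add: vec_eq_iff)
  have "?V \<noteq> 0" using T b_nonzero by auto
  then have "pos_vec ?V"
    using positive_definite_Z_pos[OF irreducible_sym_Z_add_diag[OF A_irr] g_mat_factor_pd[OF assms]]
      T b_nonneg by metis
  then show ?thesis using \<mu> eq by (simp add: critical_def sym_jac_eq_0_iff)
qed

section \<open>The symmetrized matrix \<open>h_mat\<close> and the parametrization
  \<open>phi\<close>\<close>

lemma h_mat_nth: "h_mat A l $ i $ j = (l $ i + l $ j) / 2 * A $ i $ j"
  by (simp add: h_mat_def algebra_simps)

lemma h_mat_mult_nth: "(h_mat A l *v x) $ i = (l $ i * (A *v x) $ i + (A *v (diag l *v x)) $ i) / 2"
proof -
  have "(A *v (diag l *v x)) $ i = (\<Sum>j\<in>UNIV. A $ i $ j * (l $ j * x $ j))"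
    unfolding matrix_vector_mult_def[of A] by simp
  moreover have "(h_mat A l *v x) $ i = (\<Sum>j\<in>UNIV. (l $ i * (A $ i $ j * x $ j) + A $ i $ j * (l $ j * x $ j)) / 2)"
    unfolding matrix_vector_mult_def[of "h_mat A l"] by (simp add: h_mat_nth algebra_simps)
  ultimately show ?thesis
    by (simp add: matrix_vector_mult_def sum_distrib_left sum.distrib flip: sum_divide_distrib)
qed

text \<open>Entries of \<open>A\<close> are multiplied by positive factors symmetric in
  \<open>i\<close> and \<open>j\<close>, which preserves signs, zeros and symmetry.\<close>

lemma h_mat_irr:
  assumes "pos_vec l"
  shows "irreducible_sym_Z (h_mat A l)"
proof -
  have l: "0 < l $ i + l $ j" for i j using assms by (simp add: pos_vec_def add_pos_pos)
  then have "l $ i + l $ j \<noteq> 0" for i j by (metis less_irrefl)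
  moreover have "A $ i $ j = A $ j $ i" for i j
    using A_sym by (auto simp: symmetric_matrix_def transpose_def vec_eq_iff)
  ultimately show ?thesis
    using A_Z A_irreducible l
    unfolding irreducible_sym_Z_def symmetric_matrix_def Z_matrix_def irreducible_matrix_def
    by (auto simp: h_mat_nth transpose_def vec_eq_iff add.commute mult_nonneg_nonpos less_imp_le)
qed

text \<open>\<open>h_mat A l\<close> is the symmetric part of \<open>diag l ** A\<close> and so has
  the same quadratic form.\<close>

lemma h_mat_form:
  "x \<bullet> (h_mat A l *v x) = (\<Sum>i\<in>UNIV. l $ i * x $ i * (A *v x) $ i)"
proof -
  have "x \<bullet> (A *v (diag l *v x)) = (diag l *v x) \<bullet> (A *v x)"
    by (rule symmetric_matrix_inner[OF A_sym])
  then show ?thesis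
    by (simp add: inner_vec_def h_mat_mult_nth distrib_left add_divide_distrib sum.distrib
        flip: sum_divide_distrib) (simp add: ac_simps)
qed

lemma Lambda_set_pos_vec:
  assumes "l \<in> Lambda_set A"
  shows "pos_vec l"
proof -
  have "0 < h_mat A l $ i $ i" for i
    using assms by (simp add: Lambda_set_def positive_definite_nth_pos)
  then have "0 < l $ i * A $ i $ i" for i by (simp add: h_mat_nth)
  then show ?thesis
    using positive_definite_nth_pos[OF A_pd] by (metis pos_vec_def zero_less_mult_pos2)
qed

text \<open>For positive \<open>V\<close> and \<open>x = diag l *v V\<close>, the equation of
  \<open>sym_jac_eq_0_iff\<close> divided by \<open>V\<close> is this one. The factor 1/2 in
  \<open>phi\<close> cancels that in \<open>h_mat\<close>.\<close>

lemma phi_eq_iff: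
  assumes "l \<in> Lambda_set A"
  shows "phi A b l = V \<longleftrightarrow> (\<forall>i. l $ i * (b $ i - (A *v V) $ i) = (A *v (diag l *v V)) $ i)"
proof -
  have "invertible (h_mat A l)"
    using assms by (simp add: Lambda_set_def positive_definite_invertible)
  then have "phi A b l = V \<longleftrightarrow> h_mat A l *v (2 *\<^sub>R V) = diag l *v b"
    using matrix_inv_mult_eq_iff[of "h_mat A l" "diag l *v b" "2 *\<^sub>R V"]
    by (auto simp: phi_def)
  moreover have "(h_mat A l *v (2 *\<^sub>R V)) $ i = l $ i * (A *v V) $ i + (A *v (diag l *v V)) $ i" for i
    by (simp add: matrix_vector_mult_scaleR h_mat_mult_nth)
  ultimately show ?thesis
    unfolding vec_eq_iff by (auto simp: right_diff_distrib diff_eq_eq add.commute)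
qed

lemma phi_pos_vec:
  assumes l: "l \<in> Lambda_set A"
  shows "pos_vec (phi A b l)"
proof -
  let ?V = "phi A b l"
  have l_pos: "pos_vec l" using Lambda_set_pos_vec[OF l] .
  have "\<forall>i. l $ i * (b $ i - (A *v ?V) $ i) = (A *v (diag l *v ?V)) $ i"
    using phi_eq_iff[OF l] by blast
  then have h: "(h_mat A l *v ?V) $ i = l $ i * b $ i / 2" for i
    by (simp add: h_mat_mult_nth algebra_simps)
  then have "0 \<le> h_mat A l *v ?V"
    using b_nonneg pos_vec_nonneg[OF l_pos] unfolding less_eq_vec_def h by simp
  moreover have "?V \<noteq> 0"
    using h b_nonzero l_pos by (metis divide_eq_0_iff less_irrefl matrix_vector_mult_0_right
        mult_eq_0_iff pos_vec_def vec_eq_iff zero_index zero_neq_numeral)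
  ultimately show ?thesis
    using positive_definite_Z_pos[OF h_mat_irr[OF l_pos]] l by (simp add: Lambda_set_def)
qed

text \<open>The kernel equation replaces A [l] V by [l] (b - A V), so the terms with A V cancel in
  \<open>h_mat A l *v V\<close>. What is left is half of [l] b, nonnegative and nonzero, and
  \<open>V\<close> is a positive test vector.\<close>

lemma critical_Lambda_set:
  assumes crit: "critical V (diag l *v V)" and l: "pos_vec l"
  shows "l \<in> Lambda_set A" "phi A b l = V"
proof -
  have V: "pos_vec V" using crit by (simp add: critical_def)
  have eq: "l $ i * (b $ i - (A *v V) $ i) = (A *v (diag l *v V)) $ i" for i
    using critical_eq[OF crit, of i] V by (simp add: pos_vec_def less_imp_neq[symmetric])
  then have h: "(h_mat A l *v V) $ i = l $ i * b $ i / 2" for i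
    by (simp add: h_mat_mult_nth algebra_simps)
  then have "0 \<le> h_mat A l *v V"
    using b_nonneg pos_vec_nonneg[OF l] unfolding less_eq_vec_def h by simp
  moreover have "h_mat A l *v V \<noteq> 0"
    using h b_nonzero l by (metis divide_eq_0_iff less_irrefl
        mult_eq_0_iff pos_vec_def vec_eq_iff zero_index zero_neq_numeral)
  ultimately show L: "l \<in> Lambda_set A"
    using positive_definiteI_pos_vec[OF h_mat_irr[OF l] V] by (simp add: Lambda_set_def)
  show "phi A b l = V" using phi_eq_iff[OF L] eq by blast
qed

lemma Lambda_set_critical:
  assumes l: "l \<in> Lambda_set A"
  shows "critical (phi A b l) (diag l *v phi A b l)"
proof -
  have "\<forall>i. l $ i * (b $ i - (A *v phi A b l) $ i) = (A *v (diag l *v phi A b l)) $ i"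
    using phi_eq_iff[OF l] by blast
  then show ?thesis
    using phi_pos_vec[OF l] Lambda_set_pos_vec[OF l]
    by (simp add: critical_def sym_jac_eq_0_iff) (simp add: pos_vec_def ac_simps)
qed

text \<open>\<open>l\<close> annihilates the Jacobian at \<open>V\<close> from the left, so only the quadratic term of \<open>P_c\<close> survives.\<close>

lemma critical_inner_P_c:
  assumes crit: "critical V (diag l *v V)"
  shows "l \<bullet> (P_c A b W - P_c A b V) = - ((W - V) \<bullet> (h_mat A l *v (W - V)))"
proof -
  define d where "d = W - V"
  have V: "pos_vec V" using crit by (simp add: critical_def)
  have eq: "l $ i * (b $ i - (A *v V) $ i) = (A *v (diag l *v V)) $ i" for i
    using critical_eq[OF crit, of i] V by (simp add: pos_vec_def less_imp_neq[symmetric])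
  have "d \<bullet> (A *v (diag l *v V)) = (diag l *v V) \<bullet> (A *v d)"
    by (rule symmetric_matrix_inner[OF A_sym])
  \<comment> \<open>By symmetry of \<open>A\<close> and the kernel equation the two linear
    contributions in \<open>d\<close> agree, so they cancel in the difference.\<close>
  then have lin: "(\<Sum>i\<in>UNIV. d $ i * (l $ i * (b $ i - (A *v V) $ i))) = (\<Sum>i\<in>UNIV. l $ i * V $ i * (A *v d) $ i)"
    by (simp add: inner_vec_def eq)
  have "W = V + d" by (simp add: d_def)
  then have "l \<bullet> (P_c A b W - P_c A b V) =
    (\<Sum>i\<in>UNIV. d $ i * (l $ i * (b $ i - (A *v V) $ i)) - l $ i * V $ i * (A *v d) $ i - l $ i * d $ i * (A *v d) $ i)"
    by (auto simp: inner_vec_def P_c_nth matrix_vector_right_distrib algebra_simps intro!: sum.cong)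
  then show ?thesis
    unfolding h_mat_form d_def[symmetric] by (simp add: sum_subtractf lin)
qed

subsection \<open>Boundaries\<close>

text \<open>Summing the entries of \<open>P_c A b V\<close> gives V.b - V.AV, in which the positive
  definite quadratic term dominates for large \<open>V\<close>.\<close>

lemma bounded_P_c_superlevel: "bounded {V. p \<le> P_c A b V}"
proof -
  obtain \<theta> x where x: "norm x = 1" "x \<bullet> (A *v x) = \<theta>" and min: "\<And>y. \<theta> * (y \<bullet> y) \<le> y \<bullet> (A *v y)"
    using symmetric_min_eigenvalue[OF A_sym] by metis
  have "x \<noteq> 0" using x(1) by auto
  then have \<theta>: "0 < \<theta>" using A_pd x(2) by (auto simp: positive_definite_def)
  define c where "c = norm b + \<bar>1 \<bullet> p\<bar>"
  have "norm V \<le> max 1 (c / \<theta>)" if V: "p \<le> P_c A b V" for V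
  proof (cases "norm V \<le> 1")
    case False
    have "0 \<le> 1 \<bullet> (P_c A b V - p)"
      using V by (intro inner_nonneg_vec) (auto simp: less_eq_vec_def)
    also have "1 \<bullet> (P_c A b V - p) = V \<bullet> b - V \<bullet> (A *v V) - 1 \<bullet> p"
      by (simp add: inner_diff_right) (simp add: inner_vec_def P_c_nth right_diff_distrib sum_subtractf)
    finally have "\<theta> * (norm V)\<^sup>2 \<le> V \<bullet> b - 1 \<bullet> p"
      using min[of V] by (simp add: power2_norm_eq_inner)
    also have "\<dots> \<le> norm V * norm b + \<bar>1 \<bullet> p\<bar>"
      using Cauchy_Schwarz_ineq2[of V b] by linarith
    \<comment> \<open>Outside the unit ball the constant may be multiplied by \<open>norm V\<close>,
      after which one factor \<open>norm V\<close> cancels.\<close>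
    also have "\<dots> \<le> norm V * norm b + norm V * \<bar>1 \<bullet> p\<bar>"
      using False mult_right_mono[of 1 "norm V" "\<bar>1 \<bullet> p\<bar>"] by simp
    finally have "norm V * (\<theta> * norm V) \<le> norm V * c"
      by (simp add: c_def power2_eq_square algebra_simps)
    moreover have "0 < norm V" using False by linarith
    ultimately have "\<theta> * norm V \<le> c" by (metis mult_le_cancel_left_pos)
    then show ?thesis using \<theta> by (simp add: le_max_iff_disj field_simps)
  qed simp
  then show ?thesis by (auto intro: boundedI)
qed

lemma compact_P_c_superlevel: "compact {V. 0 \<le> V \<and> p \<le> P_c A b V}"
proof -
  have "closed {V. 0 \<le> V \<and> p \<le> P_c A b V}"
    unfolding less_eq_vec_def P_c_nth
    by (intro closed_Collect_conj closed_Collect_all closed_Collect_le continuous_intros)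
  moreover have "bounded {V. 0 \<le> V \<and> p \<le> P_c A b V}"
    by (rule bounded_subset[OF bounded_P_c_superlevel[of p]]) auto
  ultimately show ?thesis by (simp add: compact_eq_bounded_closed)
qed

text \<open>A maximal \<open>V\<close> with \<open>p \<le> P_c V\<close> solves \<open>P_c V = p\<close>: raising a single coordinate \<open>V\<^sub>i\<close>
  does not decrease the other entries of \<open>P_c V\<close>.\<close>

lemma maximal_solution:
  assumes V0: "0 \<le> V0" "p \<le> P_c A b V0"
  obtains V where "pos_vec V" "P_c A b V = p"
    "\<And>W. V \<le> W \<Longrightarrow> p \<le> P_c A b W \<Longrightarrow> W = V"
proof -
  let ?K = "{V. 0 \<le> V \<and> p \<le> P_c A b V}"
  have "?K \<noteq> {}" using V0 by auto
  \<comment> \<open>A maximiser of the coordinate sum over the compact set \<open>?K\<close> is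
    maximal in the entrywise order.\<close>
  moreover have "continuous_on ?K (\<lambda>V. 1 \<bullet> V)" by (intro continuous_intros)
  ultimately obtain V where V: "0 \<le> V" "p \<le> P_c A b V" and max: "\<And>W. W \<in> ?K \<Longrightarrow> 1 \<bullet> W \<le> 1 \<bullet> V"
    using continuous_attains_sup[OF compact_P_c_superlevel] by (metis (no_types, lifting) mem_Collect_eq)
  have maximal: "W = V" if W: "V \<le> W" "p \<le> P_c A b W" for W
  proof (rule ccontr)
    assume "W \<noteq> V"
    then have "0 < 1 \<bullet> (W - V)"
      using W(1) by (intro inner_pos_vec) (auto simp: pos_vec_def less_eq_vec_def)
    moreover have "W \<in> ?K" using V(1) W by auto
    ultimately show False using max[of W] by (simp add: inner_diff_right)
  qed
  have V_nth: "0 \<le> V $ i" for i using V(1) by (simp add: less_eq_vec_def)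
  have Vp: "p $ i \<le> V $ i * (b $ i - (A *v V) $ i)" for i
    using V(2) by (simp add: less_eq_vec_def P_c_nth)
  \<comment> \<open>The left side is entry \<open>i\<close> of \<open>P_c\<close> after raising
    \<open>V $ i\<close> by \<open>t\<close>. If it still reached \<open>p $ i\<close>, the raised
    point would contradict maximality.\<close>
  have bump: "(V $ i + t) * (b $ i - (A *v V) $ i - t * A $ i $ i) < p $ i" if t: "0 < t" for i t
  proof (rule ccontr)
    assume i: "\<not> ?thesis"
    define W where "W = V + t *\<^sub>R axis i 1"
    have AW: "(A *v W) $ j = (A *v V) $ j + t * A $ j $ i" for j
      by (simp add: W_def matrix_vector_right_distrib matrix_vector_mult_scaleR
          matrix_vector_mult_basis column_def)
    have "p $ j \<le> P_c A b W $ j" for j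
    proof (cases "j = i")
      case True
      then show ?thesis using i by (simp add: P_c_nth AW) (simp add: W_def algebra_simps)
    next
      case False
      then have "A $ j $ i \<le> 0" using A_Z by (auto simp: Z_matrix_def)
      then have "0 \<le> V $ j * (t * - (A $ j $ i))"
        using t V_nth by (intro mult_nonneg_nonneg) auto
      moreover have "W $ j = V $ j" using False by (simp add: W_def axis_def)
      ultimately show ?thesis
        using Vp[of j] unfolding P_c_nth AW by (simp add: algebra_simps)
    qed
    moreover have "V \<le> W" using t by (simp add: W_def less_eq_vec_def axis_def)
    ultimately have "W = V" using maximal by (simp add: less_eq_vec_def)
    then have "t *\<^sub>R axis i (1::real) = 0" by (simp add: W_def)
    then show False using t by (simp add: axis_eq_0_iff)
  qed
  \<comment> \<open>Slack in entry \<open>i\<close> would by continuity survive a small raise of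
    \<open>V $ i\<close>, which \<open>bump\<close> excludes.\<close>
  have sol: "P_c A b V $ i = p $ i" for i
  proof (rule ccontr)
    assume "P_c A b V $ i \<noteq> p $ i"
    then have lt: "p $ i < V $ i * (b $ i - (A *v V) $ i)" using Vp[of i] by (simp add: P_c_nth)
    have "((\<lambda>t. (V $ i + t) * (b $ i - (A *v V) $ i - t * A $ i $ i)) \<longlongrightarrow> V $ i * (b $ i - (A *v V) $ i)) (at_right 0)"
      by (auto intro!: tendsto_eq_intros)
    from order_tendstoD(1)[OF this lt] obtain t where
      "0 < t" "p $ i < (V $ i + t) * (b $ i - (A *v V) $ i - t * A $ i $ i)"
      using eventually_happens'[OF _ eventually_conj[OF _ eventually_at_right_less[of "0::real"]]] by auto
    then show False using bump[of t i] by simp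
  qed
  have zero: "b $ i \<le> (A *v V) $ i" if "V $ i = 0" for i
  proof (rule ccontr)
    assume "\<not> ?thesis"
    moreover have Aii: "0 < A $ i $ i" by (rule positive_definite_nth_pos[OF A_pd])
    \<comment> \<open>Raising by this amount makes the second factor in \<open>bump\<close> zero and
      yields \<open>0 < p $ i\<close>, whereas \<open>V $ i = 0\<close> forces
      \<open>p $ i \<le> 0\<close>.\<close>
    ultimately have "0 < (b $ i - (A *v V) $ i) / A $ i $ i" by simp
    from bump[OF this, of i] show False using that Aii Vp[of i] by simp
  qed
  have "V \<noteq> 0"
  proof
    assume "V = 0"
    then have "b \<le> 0" using zero by (simp add: less_eq_vec_def)
    then show False using b_nonneg b_nonzero by simp
  qed
  moreover have "0 \<le> (A *v V) $ i" if "V $ i = 0" for i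
    using zero[OF that] b_nonneg by (metis less_eq_vec_def order_trans zero_index)
  ultimately have "pos_vec V"
    using irreducible_Z_pos_vec[OF A_Z A_irreducible V(1)] by blast
  moreover have "P_c A b V = p" using sol by (simp add: vec_eq_iff)
  ultimately show ?thesis using maximal that by blast
qed

section \<open>The feasible set and its frontier\<close>

text \<open>\<open>maximal_solution\<close> replaces domination at a nonnegative \<open>V\<close> by
  an exact positive solution. The relaxed form admits compactness arguments and shows that the set
  is downward closed.\<close>

lemma feasible_iff: "p \<in> feasible A b \<longleftrightarrow> (\<exists>V. 0 \<le> V \<and> p \<le> P_c A b V)"
  unfolding feasible_def by (auto intro: pos_vec_nonneg elim!: maximal_solution)

text \<open>Near \<open>p\<close> all feasible demands exceed \<open>p - 1\<close>, hence are
  attained on a compact superlevel set, whose image is closed. The limit \<open>p\<close> is then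
  attained at some \<open>V \<ge> 0\<close>, which suffices by \<open>feasible_iff\<close>.\<close>

lemma closed_feasible: "closed (feasible A b)"
proof -
  have "p \<in> feasible A b" if p: "p \<in> closure (feasible A b)" for p
  proof -
    let ?K = "{V. 0 \<le> V \<and> p - 1 \<le> P_c A b V}"
    let ?U = "{q. \<forall>i. p $ i - 1 < q $ i}"
    have U: "open ?U"
      unfolding Collect_all_eq by (intro open_INT finite ballI open_Collect_less continuous_intros)
    have "P_c A b = (\<lambda>V. \<chi> i. V $ i * (b $ i - (A *v V) $ i))"
      by (simp add: fun_eq_iff vec_eq_iff P_c_nth)
    then have "continuous_on ?K (P_c A b)" by (auto intro!: continuous_intros)
    then have "closed (P_c A b ` ?K)"
      by (intro compact_imp_closed compact_continuous_image compact_P_c_superlevel)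
    moreover have "?U \<inter> feasible A b \<subseteq> P_c A b ` ?K"
      by (auto simp: feasible_def less_eq_vec_def pos_vec_def less_imp_le intro!: imageI)
    ultimately have "closure (?U \<inter> feasible A b) \<subseteq> P_c A b ` ?K" by (rule closure_minimal[rotated])
    moreover have "p \<in> ?U \<inter> closure (feasible A b)" using p by simp
    ultimately have "p \<in> P_c A b ` ?K" using open_Int_closure_subset[OF U] by blast
    then show ?thesis unfolding feasible_iff by auto
  qed
  then show ?thesis by (metis closure_subset closure_closed subsetI subset_antisym closed_closure)
qed

lemma P_c_less_imp_interior:
  assumes W: "0 \<le> W" and less: "\<And>i. p $ i < P_c A b W $ i"
  shows "p \<in> interior (feasible A b)"
proof (rule interiorI)
  show "open {q. \<forall>i. q $ i < P_c A b W $ i}"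
    unfolding Collect_all_eq by (intro open_INT finite ballI open_Collect_less continuous_intros)
  show "{q. \<forall>i. q $ i < P_c A b W $ i} \<subseteq> feasible A b"
  proof
    fix q assume "q \<in> {q. \<forall>i. q $ i < P_c A b W $ i}"
    then have "q \<le> P_c A b W" by (simp add: less_eq_vec_def less_imp_le)
    then show "q \<in> feasible A b" using W feasible_iff by blast
  qed
qed (use less in simp)

text \<open>At a maximal solution \<open>V\<close> the smallest eigenvalue \<open>\<theta>\<close>
  must vanish. If it is negative, moving up along the Perron vector does not lower any demand,
  against maximality; if positive, moving down raises every demand, so \<open>p\<close> is
  interior.\<close>

lemma frontier_feasible_critical:
  assumes "p \<in> frontier (feasible A b)"
  obtains V \<mu> where "critical V \<mu>" "P_c A b V = p"
proof -
  have int: "p \<notin> interior (feasible A b)" and "p \<in> feasible A b"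
    using assms closed_feasible by (auto simp: frontier_def)
  then obtain V where V: "pos_vec V" "P_c A b V = p"
    and maximal: "\<And>W. V \<le> W \<Longrightarrow> p \<le> P_c A b W \<Longrightarrow> W = V"
    using maximal_solution unfolding feasible_iff by metis
  obtain \<theta> x where x: "pos_vec x" and eig: "sym_jac V *v x = \<theta> *\<^sub>R x"
    using perron_sym_Z[OF sym_jac_irr] by metis
  have V0: "0 < V $ i" and x0: "0 < x $ i" for i using V x by (auto simp: pos_vec_def)
  have P: "P_c A b (V + t *\<^sub>R x) $ i = p $ i - t * (x $ i * (\<theta> * V $ i + t * (A *v x) $ i))" for t i
    unfolding P_c_add_scaled_nth[OF V(1)] V(2) eig by (simp add: algebra_simps)
  have lim: "((\<lambda>t. \<theta> * V $ i + t * (A *v x) $ i) \<longlongrightarrow> \<theta> * V $ i) (at 0)" for i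
    by (auto intro!: tendsto_eq_intros)
  have "\<theta> = 0"
  proof (rule linorder_cases[of \<theta> 0])
    assume "\<theta> < 0"
    then have "eventually (\<lambda>t. \<theta> * V $ i + t * (A *v x) $ i < 0) (at_right 0)" for i
      using V0[of i] by (intro order_tendstoD(2)[OF tendsto_within_subset[OF lim]]) (auto simp: mult_neg_pos)
    then have "eventually (\<lambda>t. \<forall>i. \<theta> * V $ i + t * (A *v x) $ i < 0) (at_right 0)"
      by (intro eventually_all_finite)
    then obtain t where t: "0 < t" "\<And>i. \<theta> * V $ i + t * (A *v x) $ i < 0"
      using eventually_happens'[OF _ eventually_conj[OF _ eventually_at_right_less[of "0::real"]]] by auto
    have "t * (x $ i * (\<theta> * V $ i + t * (A *v x) $ i)) \<le> 0" for i
      using t x0[of i] by (intro mult_nonneg_nonpos) (auto simp: less_imp_le)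
    then have "p \<le> P_c A b (V + t *\<^sub>R x)" by (simp add: less_eq_vec_def P)
    moreover have "V \<le> V + t *\<^sub>R x" using t(1) x0 by (simp add: less_eq_vec_def less_imp_le)
    ultimately have "t *\<^sub>R x = 0" using maximal by fastforce
    then show ?thesis using t(1) pos_vec_nonzero[OF x] by simp
  next
    assume "0 < \<theta>"
    then have "eventually (\<lambda>t. 0 < \<theta> * V $ i + t * (A *v x) $ i) (at_left 0)" for i
      using V0[of i] by (intro order_tendstoD(1)[OF tendsto_within_subset[OF lim]]) auto
    moreover have "eventually (\<lambda>t. 0 < V $ i + t * x $ i) (at_left 0)" for i
      by (rule order_tendstoD(1)[OF _ V0[of i]]) (auto intro!: tendsto_eq_intros)
    ultimately have "eventually (\<lambda>t. (\<forall>i. 0 < \<theta> * V $ i + t * (A *v x) $ i) \<and> (\<forall>i. 0 < V $ i + t * x $ i)) (at_left 0)"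
      by (intro eventually_conj eventually_all_finite)
    moreover have "eventually (\<lambda>t. t < 0) (at_left (0::real))"
      by (simp add: eventually_at_filter)
    ultimately obtain t where t: "t < 0" "\<And>i. 0 < \<theta> * V $ i + t * (A *v x) $ i" "\<And>i. 0 < V $ i + t * x $ i"
      using eventually_happens'[OF _ eventually_conj[of _ "at_left (0::real)"]] by (metis (no_types, lifting) trivial_limit_at_left_real)
    have "t * (x $ i * (\<theta> * V $ i + t * (A *v x) $ i)) < 0" for i
      using t x0[of i] by (intro mult_neg_pos mult_pos_pos) auto
    then have "p \<in> interior (feasible A b)"
      using t(3) by (intro P_c_less_imp_interior[of "V + t *\<^sub>R x"]) (auto simp: less_eq_vec_def P less_imp_le)
    then show ?thesis using int by simp
  qed
  then have "critical V x" using V x eig by (simp add: critical_def)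
  then show ?thesis using V(2) that by blast
qed

lemma critical_obtain_Lambda:
  assumes "critical V \<mu>"
  defines "l \<equiv> \<chi> i. \<mu> $ i / V $ i"
  shows "pos_vec l" "diag l *v V = \<mu>" "l \<in> Lambda_set A" "phi A b l = V"
proof -
  have V0: "0 < V $ i" and \<mu>0: "0 < \<mu> $ i" for i using assms by (auto simp: critical_def pos_vec_def)
  show l: "pos_vec l" using V0 \<mu>0 by (simp add: l_def pos_vec_def)
  show eq: "diag l *v V = \<mu>" using V0 by (simp add: l_def vec_eq_iff less_imp_neq[symmetric])
  show "l \<in> Lambda_set A" "phi A b l = V"
    using critical_Lambda_set[OF _ l] assms(1) eq by auto
qed

text \<open>By \<open>critical_inner_P_c\<close> the linear functional \<open>l\<close> attains its
  maximum over the feasible set at \<open>P_c A b V\<close>: \<open>l\<close> is normal to a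
  supporting hyperplane.\<close>

lemma critical_in_frontier_feasible:
  assumes crit: "critical V \<mu>"
  shows "P_c A b V \<in> frontier (feasible A b)"
proof -
  obtain l where l: "pos_vec l" "diag l *v V = \<mu>" "l \<in> Lambda_set A"
    using critical_obtain_Lambda[OF crit] by blast
  have le: "l \<bullet> q \<le> l \<bullet> P_c A b V" if q_feasible: "q \<in> feasible A b" for q
  proof -
    obtain W where q: "q = P_c A b W" using q_feasible by (auto simp: feasible_def)
    have "0 \<le> (W - V) \<bullet> (h_mat A l *v (W - V))"
      using l(3) by (cases "W = V") (auto simp: Lambda_set_def positive_definite_def less_imp_le)
    then show ?thesis
      using critical_inner_P_c[of V l W] crit l(2) by (simp add: q inner_diff_right)
  qed
  have "P_c A b V \<notin> interior (feasible A b)"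
  proof
    assume "P_c A b V \<in> interior (feasible A b)"
    then obtain e where e: "0 < e" "ball (P_c A b V) e \<subseteq> feasible A b"
      by (auto simp: mem_interior)
    have l0: "0 < norm l" using pos_vec_nonzero[OF l(1)] by simp
    \<comment> \<open>A step of length \<open>e / 2\<close> along \<open>l\<close> stays in the ball
      but increases the functional.\<close>
    define q where "q = P_c A b V + (e / (2 * norm l)) *\<^sub>R l"
    have "q \<in> feasible A b" using e l0 by (intro subsetD[OF e(2)]) (simp add: q_def dist_norm)
    from le[OF this] have "(e / (2 * norm l)) * (l \<bullet> l) \<le> 0" by (simp add: q_def inner_add_right)
    moreover have "0 < (e / (2 * norm l)) * (l \<bullet> l)" using e(1) l0 by simp
    ultimately show False by simp
  qed
  moreover have "P_c A b V \<in> feasible A b" using crit by (auto simp: feasible_def critical_def)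
  ultimately show ?thesis using closure_subset by (auto simp: frontier_def)
qed

text \<open>Equal demands annihilate the left side of \<open>critical_inner_P_c\<close>, whose right
  side is definite.\<close>

lemma critical_P_c_inj:
  assumes "critical V \<mu>" "P_c A b W = P_c A b V"
  shows "W = V"
proof -
  obtain l where l: "diag l *v V = \<mu>" "l \<in> Lambda_set A"
    using critical_obtain_Lambda[OF assms(1)] by blast
  have "(W - V) \<bullet> (h_mat A l *v (W - V)) = 0"
    using critical_inner_P_c[of V l W] assms l(1) by simp
  then show ?thesis
    using l(2) by (auto simp: Lambda_set_def positive_definite_def) (metis eq_iff_diff_eq_0 less_irrefl)
qed

section \<open>The frontier of \<open>D_set\<close>\<close>

text \<open>Scaling \<open>V\<close> up adds a positive multiple of \<open>[b/V]\<close> to \<open>sym_jac V\<close>, so \<open>V\<close> is a limit of points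
  of \<open>D_set\<close>.\<close>

lemma critical_in_frontier_D_set:
  assumes crit: "critical V \<mu>"
  shows "V \<in> frontier (D_set A b)"
proof -
  have V: "pos_vec V" and \<mu>: "pos_vec \<mu>" "sym_jac V *v \<mu> = 0" using crit by (auto simp: critical_def)
  have V0: "0 < V $ i" for i using V by (simp add: pos_vec_def)
  have "\<not> positive_definite (sym_jac V)"
    using \<mu> pos_vec_nonzero[OF \<mu>(1)] by (auto simp: positive_definite_def intro!: exI[of _ \<mu>])
  then have "V \<notin> D_set A b" by (simp add: mem_D_set_iff)
  moreover have scaled: "(1 + e) *\<^sub>R V \<in> D_set A b" if e: "0 < e" for e
  proof -
    \<comment> \<open>Scaling \<open>V\<close> leaves [A V / V] unchanged and shrinks [b / V] by the
      factor 1 / (1 + e); \<open>d\<close> is the resulting gain on the diagonal.\<close>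
    define d where "d = (\<chi> i. e / (1 + e) * (b $ i / V $ i))"
    have d: "0 \<le> d" using e b_nonneg V0 by (simp add: d_def less_eq_vec_def less_imp_le)
    have "((A *v ((1 + e) *\<^sub>R V)) $ i - b $ i) / ((1 + e) *\<^sub>R V) $ i = ((A *v V) $ i - b $ i) / V $ i + d $ i" for i
    proof -
      have "1 + e \<noteq> 0" "V $ i \<noteq> 0" using e V0[of i] by auto
      then show ?thesis
        unfolding matrix_vector_mult_scaleR d_def by (simp add: divide_simps) (simp add: algebra_simps)
    qed
    then have "sym_jac ((1 + e) *\<^sub>R V) = sym_jac V + diag d"
      by (simp add: sym_jac_def vec_eq_iff diag_nth)
    then have S: "sym_jac ((1 + e) *\<^sub>R V) *v \<mu> = diag d *v \<mu>"
      by (simp add: matrix_vector_mult_add_rdistrib \<mu>(2))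
    have "0 \<le> diag d *v \<mu>" using d pos_vec_nonneg[OF \<mu>(1)] by (simp add: less_eq_vec_def)
    moreover have "diag d *v \<mu> \<noteq> 0"
    proof -
      obtain i where "b $ i \<noteq> 0" using b_nonzero by (auto simp: vec_eq_iff)
      then have "(diag d *v \<mu>) $ i \<noteq> 0"
        using e V0[of i] \<mu>(1) by (simp add: d_def pos_vec_def less_imp_neq[symmetric])
      then show ?thesis by (metis zero_index)
    qed
    ultimately have "positive_definite (sym_jac ((1 + e) *\<^sub>R V))"
      using positive_definiteI_pos_vec[OF sym_jac_irr \<mu>(1)] S by simp
    then show ?thesis using e V0 by (simp add: mem_D_set_iff pos_vec_def)
  qed
  moreover have "((\<lambda>e. (1 + e) *\<^sub>R V) \<longlongrightarrow> V) (at_right 0)"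
    by (auto intro!: tendsto_eq_intros)
  then have "V \<in> closure (D_set A b)"
    using scaled eventually_at_right_less[of "0::real"]
    by (intro Lim_in_closed_set[OF closed_closure _ _ \<open>(_ \<longlongrightarrow> V) (at_right 0)\<close>])
       (auto elim!: eventually_mono intro: subsetD[OF closure_subset])
  ultimately show ?thesis using open_D_set by (simp add: frontier_def interior_open)
qed

lemma frontier_D_set_nonneg:
  assumes "V \<in> frontier (D_set A b)"
  shows "0 \<le> V"
proof -
  have "closed {V::real^'n. 0 \<le> V}"
    unfolding less_eq_vec_def by (intro closed_Collect_all closed_Collect_le continuous_intros)
  then have "closure (D_set A b) \<subseteq> {V. 0 \<le> V}"
    by (intro closure_minimal) (auto simp: mem_D_set_iff intro: pos_vec_nonneg)
  then show ?thesis using assms by (auto simp: frontier_def)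
qed

text \<open>A positive \<open>V $ i\<close> can be divided out. If \<open>V $ i = 0\<close>, the
  Z-matrix sign gives \<open>(A *v V) $ i \<le> 0 \<le> b $ i\<close>, so both conditions hold at
  \<open>i\<close>.\<close>

lemma P_c_nonneg_iff:
  assumes V: "0 \<le> V"
  shows "0 \<le> P_c A b V \<longleftrightarrow> A *v V \<le> b"
proof -
  have "0 \<le> V $ i * (b $ i - (A *v V) $ i) \<longleftrightarrow> (A *v V) $ i \<le> b $ i" for i
  proof (cases "V $ i = 0")
    case True
    then show ?thesis
      using Z_matrix_nth_nonpos[OF A_Z V True] b_nonneg by (simp add: less_eq_vec_def) (meson order_trans)
  next
    case False
    then have "0 < V $ i" using V by (simp add: less_eq_vec_def order.strict_iff_order)
    then show ?thesis by (simp add: zero_le_mult_iff)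
  qed
  then show ?thesis by (simp add: less_eq_vec_def P_c_nth)
qed

text \<open>Once \<open>V\<close> is known to be positive, the smallest eigenvalue is at most 0
  because \<open>V\<close> lies outside the open set \<open>D_set\<close>, and at least 0 because
  \<open>V\<close> is a limit of its points.\<close>

lemma frontier_D_set_critical:
  assumes V: "V \<in> frontier (D_set A b)" and le: "A *v V \<le> b"
  obtains \<mu> where "critical V \<mu>"
proof -
  have cl: "V \<in> closure (D_set A b)" and notin: "V \<notin> D_set A b"
    using V open_D_set by (auto simp: frontier_def interior_open)
  have V0: "0 \<le> V" by (rule frontier_D_set_nonneg[OF V])
  text \<open>The diagonal of \<open>[V] S(V)\<close> makes sense for \<open>V \<ge> 0\<close> too; its sign excludes zero coordinates of \<open>V\<close>.\<close>
  have diag_pos: "0 < U $ i * A $ i $ i + ((A *v U) $ i - b $ i)" if U: "U \<in> D_set A b" for U i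
  proof -
    have "0 < U $ i" using U by (simp add: mem_D_set_iff pos_vec_def)
    moreover have "0 < sym_jac U $ i $ i"
      using U by (intro positive_definite_nth_pos) (simp add: mem_D_set_iff)
    ultimately have "0 < U $ i * sym_jac U $ i $ i" by simp
    then show ?thesis
      using \<open>0 < U $ i\<close> by (simp add: sym_jac_def diag_nth distrib_left less_imp_neq[symmetric])
  qed
  have "closed {U. \<forall>i. 0 \<le> U $ i * A $ i $ i + ((A *v U) $ i - b $ i)}"
    by (intro closed_Collect_all closed_Collect_le continuous_intros)
  then have "closure (D_set A b) \<subseteq> {U. \<forall>i. 0 \<le> U $ i * A $ i $ i + ((A *v U) $ i - b $ i)}"
    using diag_pos by (intro closure_minimal) (auto intro: less_imp_le)
  then have diag_nonneg: "0 \<le> V $ i * A $ i $ i + ((A *v V) $ i - b $ i)" for i using cl by auto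
  have zero: "b $ i \<le> (A *v V) $ i" if "V $ i = 0" for i using diag_nonneg[of i] that by simp
  have "V \<noteq> 0"
  proof
    assume "V = 0"
    then have "b \<le> 0" using zero by (simp add: less_eq_vec_def)
    then show False using b_nonneg b_nonzero by simp
  qed
  moreover have "0 \<le> (A *v V) $ i" if "V $ i = 0" for i
    using zero[OF that] b_nonneg by (metis less_eq_vec_def order_trans zero_index)
  ultimately have pos: "pos_vec V"
    using irreducible_Z_pos_vec[OF A_Z A_irreducible V0] by blast
  obtain \<theta> x where x: "pos_vec x" and eig: "sym_jac V *v x = \<theta> *\<^sub>R x"
      and min: "\<And>y. \<theta> * (y \<bullet> y) \<le> y \<bullet> (sym_jac V *v y)"
    using perron_sym_Z[OF sym_jac_irr] by metis
  \<comment> \<open>The form of \<open>sym_jac U\<close> at the fixed vector \<open>x\<close>,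
    written out so that its continuity in \<open>U\<close> at the positive \<open>V\<close> is
    visible.\<close>
  define F where "F U = x \<bullet> (A *v x) + (\<Sum>i\<in>UNIV. ((A *v U) $ i - b $ i) / U $ i * (x $ i)\<^sup>2)" for U
  have F: "F U = x \<bullet> (sym_jac U *v x)" for U
    by (simp add: F_def sym_jac_def matrix_vector_mult_add_rdistrib inner_add_right)
       (simp add: inner_vec_def power2_eq_square ac_simps)
  have "\<theta> \<le> 0"
  proof (rule ccontr)
    assume "\<not> \<theta> \<le> 0"
    then have "y \<noteq> 0 \<Longrightarrow> 0 < y \<bullet> (sym_jac V *v y)" for y
      using min[of y] by (smt (verit) inner_gt_zero_iff mult_pos_pos)
    then have "positive_definite (sym_jac V)"
      using sym_jac_irr by (simp add: positive_definite_def irreducible_sym_Z_def)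
    then show False using notin pos by (simp add: mem_D_set_iff)
  qed
  moreover have "0 \<le> F V"
  proof -
    obtain U where U: "\<And>n. U n \<in> D_set A b" "U \<longlonglongrightarrow> V"
      using cl by (auto simp: closure_sequential)
    have "(\<lambda>n. F (U n)) \<longlonglongrightarrow> F V"
      unfolding F_def using pos U(2)
      by (auto simp: pos_vec_def less_imp_neq[symmetric] intro!: tendsto_intros
          tendsto_vec_nth bounded_linear.tendsto[OF matrix_vector_mul_bounded_linear])
    moreover have "0 \<le> F (U n)" for n
      using U(1)[of n] pos_vec_nonzero[OF x] by (auto simp: F mem_D_set_iff positive_definite_def less_imp_le)
    ultimately show ?thesis by (metis LIMSEQ_le_const)
  qed
  then have "0 \<le> \<theta> * (x \<bullet> x)" unfolding F eig by simp
  then have "0 \<le> \<theta>" using pos_vec_nonzero[OF x] by (metis inner_gt_zero_iff mult_neg_pos not_le)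
  ultimately have "\<theta> = 0" by simp
  then show ?thesis using that x pos eig by (simp add: critical_def)
qed

subsection \<open>The correspondence\<close>

lemma critical_scaleR: "critical V \<mu> \<Longrightarrow> 0 < c \<Longrightarrow> critical V (c *\<^sub>R \<mu>)"
  by (auto simp: critical_def pos_vec_def matrix_vector_mult_scaleR)

lemma critical_unique:
  assumes "critical V \<mu>" "critical V \<mu>'"
  obtains c where "\<mu>' = c *\<^sub>R \<mu>"
  using null_space_dim_1[OF sym_jac_irr] assms unfolding critical_def by metis

lemma critical_imp_psi:
  assumes "critical V \<mu>" "0 \<le> A *v \<mu>"
  shows "psi A b \<mu> = V"
  using psi_eq_iff[OF assms(2)] critical_eq[OF assms(1)] assms(1) pos_vec_nonzero
  unfolding critical_def by blast

abbreviation mu_of :: "real^'n \<Rightarrow> real^'n" where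
  "mu_of \<nu> \<equiv> matrix_inv A *v \<nu>"

abbreviation V_of :: "real^'n \<Rightarrow> real^'n" where
  "V_of \<nu> \<equiv> psi A b (mu_of \<nu>)"

lemma N1_set_nonzero: "\<nu> \<in> N1_set \<Longrightarrow> 0 \<le> \<nu> \<and> \<nu> \<noteq> 0"
  by (auto simp: N1_set_def N_set_def)

lemma N1_set_scaleR_eq:
  assumes "\<nu> \<in> N1_set" "\<nu>' \<in> N1_set" "\<nu>' = c *\<^sub>R \<nu>"
  shows "\<nu>' = \<nu>"
  using assms by (simp add: N1_set_def)

lemma N1_set_critical:
  assumes "\<nu> \<in> N1_set"
  shows "critical (V_of \<nu>) (mu_of \<nu>)" "pos_vec (mu_of \<nu>)" "pos_vec (V_of \<nu>)" "A *v V_of \<nu> \<le> b"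
proof -
  have "mu_of \<nu> \<noteq> 0" using N1_set_nonzero[OF assms] A_inv[of \<nu>] by auto
  then show crit: "critical (V_of \<nu>) (mu_of \<nu>)"
    using N1_set_nonzero[OF assms] by (intro critical_psi) (simp_all add: A_inv)
  then show "pos_vec (mu_of \<nu>)" "pos_vec (V_of \<nu>)" by (auto simp: critical_def)
  show "A *v V_of \<nu> \<le> b"
    using critical_nonneg_iff[OF crit] N1_set_nonzero[OF assms] by (simp add: A_inv)
qed

lemma N1_set_chi:
  assumes \<nu>: "\<nu> \<in> N1_set"
  shows "chi A b \<nu> = (\<chi> i. mu_of \<nu> $ i / V_of \<nu> $ i)" "chi A b \<nu> \<in> Lambda_set A"
    "pos_vec (chi A b \<nu>)" "diag (chi A b \<nu>) *v V_of \<nu> = mu_of \<nu>" "phi A b (chi A b \<nu>) = V_of \<nu>"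
proof -
  show eq: "chi A b \<nu> = (\<chi> i. mu_of \<nu> $ i / V_of \<nu> $ i)"
    using N1_set_critical(3)[OF \<nu>] by (simp add: chi_def vec_eq_iff matrix_inv_diag_mult_nth)
  show "chi A b \<nu> \<in> Lambda_set A" "pos_vec (chi A b \<nu>)"
    "diag (chi A b \<nu>) *v V_of \<nu> = mu_of \<nu>" "phi A b (chi A b \<nu>) = V_of \<nu>"
    unfolding eq using critical_obtain_Lambda[OF N1_set_critical(1)[OF \<nu>]] by auto
qed

text \<open>Scaling \<open>l\<close> scales the kernel vector \<open>diag l *v V\<close> and leaves
  \<open>V\<close> critical, so \<open>phi\<close> does not change under normalization.\<close>

lemma N1_set_lambda:
  assumes \<nu>: "\<nu> \<in> N1_set"
  shows "normalize1 (chi A b \<nu>) \<in> Lambda1_set A" "phi A b (normalize1 (chi A b \<nu>)) = V_of \<nu>"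
    "diag (normalize1 (chi A b \<nu>)) *v V_of \<nu> = (1 / norm1 (chi A b \<nu>)) *\<^sub>R mu_of \<nu>"
    "0 < norm1 (chi A b \<nu>)"
proof -
  let ?l = "normalize1 (chi A b \<nu>)"
  show c: "0 < norm1 (chi A b \<nu>)" by (rule norm1_pos[OF N1_set_chi(3)[OF \<nu>]])
  show eq: "diag ?l *v V_of \<nu> = (1 / norm1 (chi A b \<nu>)) *\<^sub>R mu_of \<nu>"
    by (simp only: normalize1_def diag_scaleR_mult N1_set_chi(4)[OF \<nu>])
  have "critical (V_of \<nu>) (diag ?l *v V_of \<nu>)"
    unfolding eq using c by (intro critical_scaleR N1_set_critical \<nu>) simp
  moreover have "pos_vec ?l"
    using N1_set_chi(3)[OF \<nu>] c by (simp add: normalize1_def pos_vec_def)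
  ultimately show "?l \<in> Lambda1_set A" "phi A b ?l = V_of \<nu>"
    using critical_Lambda_set norm1_normalize1[OF N1_set_chi(3)[OF \<nu>]] by (auto simp: Lambda1_set_def)
qed

text \<open>The kernel of \<open>sym_jac\<close> at the common point is one-dimensional, so the two
  parameters are proportional; their coordinate sums agree.\<close>

lemma V_of_inj:
  assumes "\<nu> \<in> N1_set" "\<nu>' \<in> N1_set" "V_of \<nu> = V_of \<nu>'"
  shows "\<nu> = \<nu>'"
proof -
  obtain c where "mu_of \<nu> = c *\<^sub>R mu_of \<nu>'"
    using critical_unique N1_set_critical(1) assms by metis
  then have "\<nu> = c *\<^sub>R \<nu>'" by (metis A_inv matrix_vector_mult_scaleR)
  then show ?thesis using N1_set_scaleR_eq assms by blast
qed

lemma N1_set_obtain: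
  assumes "0 \<le> A *v \<mu>" "\<mu> \<noteq> 0"
  obtains \<nu> c where "\<nu> \<in> N1_set" "0 < c" "mu_of \<nu> = c *\<^sub>R \<mu>"
proof -
  define s where "s = 1 \<bullet> (A *v \<mu>)"
  have "A *v \<mu> \<noteq> 0" using assms(2) A_inv_eq_iff[of 0 \<mu>] A_inv_eq_iff[of 0 0] by auto
  then have s: "0 < s"
    unfolding s_def using assms(1) by (intro inner_pos_vec) (simp_all add: pos_vec_def)
  have "(1 / s) *\<^sub>R (A *v \<mu>) \<in> N1_set"
    using s assms(1) by (simp add: N1_set_def N_set_def s_def[symmetric] less_eq_vec_def)
  moreover have "mu_of ((1 / s) *\<^sub>R (A *v \<mu>)) = (1 / s) *\<^sub>R \<mu>"
    by (simp add: A_inv_eq_iff matrix_vector_mult_scaleR)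
  ultimately show ?thesis using that s by (metis zero_less_divide_1_iff)
qed

text \<open>The common source of surjectivity onto (i), (ii) and (iv): every critical pair meeting
  the side condition comes from some \<open>\<nu>\<close>.\<close>

lemma critical_obtain_N1_set:
  assumes "critical V \<mu>" "A *v V \<le> b"
  obtains \<nu> c where "\<nu> \<in> N1_set" "V = V_of \<nu>" "0 < c" "mu_of \<nu> = c *\<^sub>R \<mu>"
proof -
  have nonneg: "0 \<le> A *v \<mu>" using critical_nonneg_iff assms by blast
  obtain \<nu> c where \<nu>: "\<nu> \<in> N1_set" and c: "0 < c" "mu_of \<nu> = c *\<^sub>R \<mu>"
    using N1_set_obtain[OF nonneg] assms(1) pos_vec_nonzero unfolding critical_def by blast
  have "critical V (mu_of \<nu>)" using critical_scaleR[OF assms(1) c(1)] c(2) by simp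
  then have "V_of \<nu> = V"
    using N1_set_nonzero[OF \<nu>] by (intro critical_imp_psi) (simp_all add: A_inv)
  then show ?thesis using that \<nu> c by blast
qed

section \<open>Bijections from \<open>N1_set\<close> onto the other four sets\<close>

lemma bij_betw_boundary_demands:
  "bij_betw (\<lambda>\<nu>. P_c A b (V_of \<nu>)) N1_set (boundary_demands A b)"
proof (rule bij_betw_imageI)
  show "inj_on (\<lambda>\<nu>. P_c A b (V_of \<nu>)) N1_set"
    by (meson N1_set_critical(1) V_of_inj critical_P_c_inj inj_onI)
  have "P_c A b (V_of \<nu>) \<in> boundary_demands A b" if "\<nu> \<in> N1_set" for \<nu>
    using N1_set_critical[OF that] critical_in_frontier_feasible P_c_nonneg_iff pos_vec_nonneg
    by (auto simp: boundary_demands_def N_set_def)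
  moreover have "p \<in> (\<lambda>\<nu>. P_c A b (V_of \<nu>)) ` N1_set" if p: "p \<in> boundary_demands A b" for p
  proof -
    obtain V \<mu> where V: "critical V \<mu>" "P_c A b V = p"
      using p frontier_feasible_critical by (auto simp: boundary_demands_def)
    then have "A *v V \<le> b"
      using p P_c_nonneg_iff[of V] pos_vec_nonneg by (auto simp: boundary_demands_def N_set_def critical_def)
    then show ?thesis using critical_obtain_N1_set[OF V(1)] V(2) by blast
  qed
  ultimately show "(\<lambda>\<nu>. P_c A b (V_of \<nu>)) ` N1_set = boundary_demands A b" by blast
qed

lemma bij_betw_boundary_operating_points: "bij_betw V_of N1_set (boundary_operating_points A b)"
proof (rule bij_betw_imageI)
  show "inj_on V_of N1_set" by (meson V_of_inj inj_onI)
  have "V_of \<nu> \<in> boundary_operating_points A b" if "\<nu> \<in> N1_set" for \<nu>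
    using N1_set_critical[OF that] critical_in_frontier_D_set by (auto simp: boundary_operating_points_def)
  moreover have "V \<in> V_of ` N1_set" if V: "V \<in> boundary_operating_points A b" for V
  proof -
    have V: "V \<in> frontier (D_set A b)" "A *v V \<le> b"
      using V by (auto simp: boundary_operating_points_def)
    obtain \<mu> where "critical V \<mu>" using frontier_D_set_critical[OF V] .
    then show ?thesis using critical_obtain_N1_set V(2) by blast
  qed
  ultimately show "V_of ` N1_set = boundary_operating_points A b" by blast
qed

lemma bij_betw_mu_parameters: "bij_betw (\<lambda>\<nu>. normalize1 (mu_of \<nu>)) N1_set (mu_parameters A)"
proof (rule bij_betw_imageI)
  show "inj_on (\<lambda>\<nu>. normalize1 (mu_of \<nu>)) N1_set"
  proof (rule inj_onI)
    fix \<nu> \<nu>' assume \<nu>: "\<nu> \<in> N1_set" "\<nu>' \<in> N1_set" "normalize1 (mu_of \<nu>) = normalize1 (mu_of \<nu>')"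
    obtain c d where c: "0 < c" "normalize1 (mu_of \<nu>) = c *\<^sub>R mu_of \<nu>"
      and d: "0 < d" "normalize1 (mu_of \<nu>') = d *\<^sub>R mu_of \<nu>'"
      using normalize1_scales N1_set_critical(2) \<nu>(1,2) by metis
    have cd: "c *\<^sub>R \<nu> = d *\<^sub>R \<nu>'" using c(2) d(2) \<nu>(3) by (metis A_inv matrix_vector_mult_scaleR)
    have "\<nu> = (1 / c) *\<^sub>R (c *\<^sub>R \<nu>)" using c(1) by simp
    also have "\<dots> = (d / c) *\<^sub>R \<nu>'" unfolding cd by simp
    finally have "\<nu> = (d / c) *\<^sub>R \<nu>'" .
    then show "\<nu> = \<nu>'" using N1_set_scaleR_eq \<nu> by blast
  qed
  have "normalize1 (mu_of \<nu>) \<in> mu_parameters A" if \<nu>: "\<nu> \<in> N1_set" for \<nu>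
  proof -
    have m: "pos_vec (mu_of \<nu>)" using N1_set_critical(2)[OF \<nu>] .
    obtain c where c: "0 < c" "normalize1 (mu_of \<nu>) = c *\<^sub>R mu_of \<nu>" using normalize1_scales[OF m] .
    have "0 \<le> A *v normalize1 (mu_of \<nu>)"
      using N1_set_nonzero[OF \<nu>] c by (simp add: matrix_vector_mult_scaleR A_inv less_eq_vec_def)
    moreover have "normalize1 (mu_of \<nu>) \<noteq> 0" using c m pos_vec_nonzero by auto
    ultimately show ?thesis
      using M_setI norm1_normalize1[OF m] by (simp add: mu_parameters_def M1_set_def N_set_def)
  qed
  moreover have "\<mu> \<in> (\<lambda>\<nu>. normalize1 (mu_of \<nu>)) ` N1_set" if "\<mu> \<in> mu_parameters A" for \<mu>
  proof -
    have \<mu>: "norm1 \<mu> = 1" "0 \<le> A *v \<mu>" using that by (auto simp: mu_parameters_def M1_set_def N_set_def)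
    then have "\<mu> \<noteq> 0" by (auto simp: norm1_def)
    then obtain \<nu> c where "\<nu> \<in> N1_set" "0 < c" "mu_of \<nu> = c *\<^sub>R \<mu>" using N1_set_obtain[OF \<mu>(2)] by blast
    then show ?thesis using normalize1_scaleR[of c \<mu>] normalize1_norm1_1[OF \<mu>(1)] by (auto intro!: image_eqI)
  qed
  ultimately show "(\<lambda>\<nu>. normalize1 (mu_of \<nu>)) ` N1_set = mu_parameters A" by blast
qed

lemma bij_betw_lambda_parameters:
  "bij_betw (\<lambda>\<nu>. normalize1 (chi A b \<nu>)) N1_set (lambda_parameters A b)"
proof (rule bij_betw_imageI)
  show "inj_on (\<lambda>\<nu>. normalize1 (chi A b \<nu>)) N1_set"
  proof (rule inj_onI)
    fix \<nu> \<nu>' assume \<nu>: "\<nu> \<in> N1_set" "\<nu>' \<in> N1_set" "normalize1 (chi A b \<nu>) = normalize1 (chi A b \<nu>')"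
    have "V_of \<nu> = V_of \<nu>'"
      using N1_set_lambda(2)[OF \<nu>(1)] N1_set_lambda(2)[OF \<nu>(2)] \<nu>(3) by simp
    then show "\<nu> = \<nu>'" using V_of_inj \<nu>(1,2) by blast
  qed
  have "normalize1 (chi A b \<nu>) \<in> lambda_parameters A b" if \<nu>: "\<nu> \<in> N1_set" for \<nu>
    using N1_set_lambda[OF \<nu>] N1_set_nonzero[OF \<nu>]
    by (simp add: lambda_parameters_def N_set_def matrix_vector_mult_scaleR A_inv less_eq_vec_def)
  moreover have "l \<in> (\<lambda>\<nu>. normalize1 (chi A b \<nu>)) ` N1_set" if "l \<in> lambda_parameters A b" for l
  proof -
    have l: "l \<in> Lambda_set A" "norm1 l = 1" "0 \<le> A *v (diag l *v phi A b l)"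
      using that by (auto simp: lambda_parameters_def Lambda1_set_def N_set_def)
    have crit: "critical (phi A b l) (diag l *v phi A b l)" using Lambda_set_critical[OF l(1)] .
    then have "A *v phi A b l \<le> b" using critical_nonneg_iff l(3) by blast
    then obtain \<nu> c where \<nu>: "\<nu> \<in> N1_set" "phi A b l = V_of \<nu>" and c: "0 < c"
      "mu_of \<nu> = c *\<^sub>R (diag l *v phi A b l)"
      using critical_obtain_N1_set[OF crit] by blast
    have "0 < phi A b l $ i" for i using crit by (simp add: critical_def pos_vec_def)
    moreover have "chi A b \<nu> $ i = mu_of \<nu> $ i / phi A b l $ i" for i
      unfolding \<nu>(2) by (simp add: N1_set_chi(1)[OF \<nu>(1)])
    \<comment> \<open>Dividing the kernel vector by the operating point recovers \<open>l\<close> up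
      to the factor \<open>c\<close>, which normalization removes.\<close>
    ultimately have "chi A b \<nu> = c *\<^sub>R l"
      unfolding c(2) by (simp add: vec_eq_iff less_imp_neq[symmetric])
    then show ?thesis
      using \<nu>(1) normalize1_scaleR[OF c(1), of l] normalize1_norm1_1[OF l(2)] by (auto intro!: image_eqI)
  qed
  ultimately show "(\<lambda>\<nu>. normalize1 (chi A b \<nu>)) ` N1_set = lambda_parameters A b" by blast
qed

lemma operating_points_eq:
  "{V \<in> frontier (D_set A b). 0 \<le> P_c A b V} = boundary_operating_points A b"
  using P_c_nonneg_iff frontier_D_set_nonneg by (auto simp: boundary_operating_points_def)

text \<open>Up to the positive factors \<open>c\<close> and \<open>d\<close>, each vector is
  \<open>mu_of \<nu>\<close>, \<open>chi A b \<nu>\<close> or \<open>\<nu>\<close>, so every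
  proportionality is read off from a common base vector.\<close>

lemma correspondence_equations:
  assumes \<nu>: "\<nu> \<in> N1_set" and V: "V = V_of \<nu>"
    and \<mu>: "\<mu> = normalize1 (mu_of \<nu>)" and l: "l = normalize1 (chi A b \<nu>)"
  shows "V = psi A b \<mu>" "V = phi A b l" "V = phi A b (chi A b \<nu>)"
    "\<mu> \<propto> diag l *v phi A b l" "diag l *v phi A b l \<propto> mu_of \<nu>"
    "l \<propto> matrix_inv (diag (psi A b \<mu>)) *v \<mu>"
    "matrix_inv (diag (psi A b \<mu>)) *v \<mu> \<propto> chi A b \<nu>"
    "\<nu> \<propto> A *v (diag l *v phi A b l)" "A *v (diag l *v phi A b l) \<propto> A *v \<mu>"
proof -
  obtain c where c: "0 < c" "\<mu> = c *\<^sub>R mu_of \<nu>"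
    using normalize1_scales[OF N1_set_critical(2)[OF \<nu>]] \<mu> by metis
  define d where "d = 1 / norm1 (chi A b \<nu>)"
  have d: "0 < d" "l = d *\<^sub>R chi A b \<nu>" "diag l *v phi A b l = d *\<^sub>R mu_of \<nu>"
    using N1_set_lambda[OF \<nu>] l by (auto simp: d_def normalize1_def)
  have A\<mu>: "A *v \<mu> = c *\<^sub>R \<nu>" and Ad: "A *v (diag l *v phi A b l) = d *\<^sub>R \<nu>"
    unfolding c(2) d(3) by (simp_all add: matrix_vector_mult_scaleR A_inv)
  have "0 \<le> A *v \<mu>"
    using A\<mu> c(1) N1_set_nonzero[OF \<nu>] by (simp add: less_eq_vec_def)
  then show psi: "V = psi A b \<mu>"
    using critical_imp_psi[OF critical_scaleR[OF N1_set_critical(1)[OF \<nu>] c(1)]] c(2) V by simp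
  show "V = phi A b l" "V = phi A b (chi A b \<nu>)"
    using N1_set_lambda(2)[OF \<nu>] N1_set_chi(5)[OF \<nu>] V l by auto
  have "psi A b \<mu> = V_of \<nu>" using psi V by simp
  then have "matrix_inv (diag (psi A b \<mu>)) *v \<mu> = matrix_inv (diag (V_of \<nu>)) *v (c *\<^sub>R mu_of \<nu>)"
    using c(2) by metis
  then have chi: "matrix_inv (diag (psi A b \<mu>)) *v \<mu> = c *\<^sub>R chi A b \<nu>"
    by (simp add: chi_def matrix_vector_mult_scaleR)
  have one: "x = 1 *\<^sub>R x" for x :: "real^'n" by simp
  show "\<mu> \<propto> diag l *v phi A b l" by (rule pos_proportionalI[OF c(2) d(3) c(1) d(1)])
  show "diag l *v phi A b l \<propto> mu_of \<nu>" by (rule pos_proportionalI[OF d(3) one d(1) zero_less_one])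
  show "l \<propto> matrix_inv (diag (psi A b \<mu>)) *v \<mu>" by (rule pos_proportionalI[OF d(2) chi d(1) c(1)])
  show "matrix_inv (diag (psi A b \<mu>)) *v \<mu> \<propto> chi A b \<nu>"
    by (rule pos_proportionalI[OF chi one c(1) zero_less_one])
  show "\<nu> \<propto> A *v (diag l *v phi A b l)" by (rule pos_proportionalI[OF one Ad zero_less_one d(1)])
  show "A *v (diag l *v phi A b l) \<propto> A *v \<mu>" by (rule pos_proportionalI[OF Ad A\<mu> d(1) c(1)])
qed

end

section \<open>From Kirchhoff matrices to load networks\<close>

lemma sum_UNIV_Plus:
  fixes f :: "'a::finite + 'b::finite \<Rightarrow> real"
  shows "(\<Sum>x\<in>UNIV. f x) = (\<Sum>i\<in>UNIV. f (Inl i)) + (\<Sum>j\<in>UNIV. f (Inr j))"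
  using sum.Plus[of "UNIV :: 'a set" "UNIV :: 'b set" f] by (simp add: comp_def)

text \<open>Without such an edge every path from a load stays among the loads, although
  connectedness leads it to a source; \<open>undefined\<close> is just some source.\<close>

lemma kirchhoff_load_source_edge:
  fixes Y :: "real^('n::finite + 'm::finite)^('n + 'm)"
  assumes "kirchhoff_matrix Y"
  obtains i k where "Y $ Inl i $ Inr k \<noteq> 0"
proof (rule ccontr)
  assume "\<not> thesis"
  then have no: "Y $ Inl i $ Inr k = 0" for i k using that by blast
  have "(x, y) \<in> {(k, l). k \<noteq> l \<and> Y $ k $ l \<noteq> 0}\<^sup>* \<Longrightarrow> x \<in> range Inl \<Longrightarrow> y \<in> range Inl" for x y
  proof (induction rule: rtrancl_induct)
    case (step y z)
    then show ?case using no by (cases z) auto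
  qed simp
  then have "(Inr undefined :: 'n + 'm) \<in> range Inl"
    using assms unfolding kirchhoff_matrix_def by blast
  then show False by auto
qed

lemma kirchhoff_load_network:
  fixes Y :: "real^('n::finite + 'm::finite)^('n + 'm)"
  assumes Y: "kirchhoff_matrix Y" and irr: "irreducible_matrix (block_LL Y)" and V: "pos_vec V"
  shows "load_network (block_LL Y) (- (block_LS Y *v V))"
proof -
  let ?A = "block_LL Y"
  have np: "Y $ Inl i $ Inr k \<le> 0" for i k using Y by (simp add: kirchhoff_matrix_def)
  \<comment> \<open>Used for \<open>V\<close> and for the all-ones vector: zero row sums make
    \<open>?A *v 1\<close> equal to \<open>- (block_LS Y *v 1)\<close>, so \<open>1\<close> is a
    test vector for positive definiteness.\<close>
  have current: "0 \<le> - (block_LS Y *v v) \<and> - (block_LS Y *v v) \<noteq> 0" if v: "pos_vec v" for v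
  proof -
    have le: "Y $ Inl i $ Inr k * v $ k \<le> 0" for i k
      using np v by (intro mult_nonpos_nonneg) (auto simp: pos_vec_def less_imp_le)
    obtain i k where ik: "Y $ Inl i $ Inr k \<noteq> 0" using kirchhoff_load_source_edge[OF Y] .
    have "Y $ Inl i $ Inr k * v $ k \<noteq> 0" using ik v by (simp add: pos_vec_def less_imp_neq[symmetric])
    then have "(\<Sum>j\<in>UNIV. - (Y $ Inl i $ Inr j * v $ j)) \<noteq> 0"
      using le by (subst sum_nonneg_eq_0_iff) auto
    then have "(block_LS Y *v v) $ i \<noteq> 0" by (simp add: block_LS_def matrix_vector_mult_def sum_negf)
    moreover have "(block_LS Y *v v) $ j \<le> 0" for j
      using le by (simp add: block_LS_def matrix_vector_mult_def sum_nonpos)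
    ultimately show ?thesis by (auto simp: less_eq_vec_def)
  qed
  have A: "irreducible_sym_Z ?A"
    using Y irr
    by (auto simp: irreducible_sym_Z_def kirchhoff_matrix_def symmetric_matrix_def Z_matrix_def
        block_LL_def transpose_def vec_eq_iff)
  have "(?A *v 1) $ i = (- (block_LS Y *v 1)) $ i" for i
  proof -
    have "(\<Sum>j\<in>UNIV. Y $ Inl i $ j) = 0" using Y by (simp add: kirchhoff_matrix_def)
    then show ?thesis
      unfolding sum_UNIV_Plus by (simp add: block_LL_def block_LS_def matrix_vector_mult_def)
  qed
  then have "?A *v 1 = - (block_LS Y *v 1)" by (simp add: vec_eq_iff)
  then have "positive_definite ?A"
    using current[of 1] by (intro positive_definiteI_pos_vec[OF A, of 1]) (simp_all add: pos_vec_def)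
  then show ?thesis using A current[OF V] by unfold_locales auto
qed

theorem theorem3p12:
  fixes Y :: "real^('n::finite + 'm::finite)^('n + 'm)"
    and V_S :: "real^'m"
    and Y_LL :: "real^'n^'n"
    and I_L :: "real^'n"
  assumes "kirchhoff_matrix Y"
    and "Y_LL = block_LL Y"
    and "irreducible_matrix Y_LL"
    and "pos_vec V_S"
    and "I_L = - (block_LS Y *v V_S)"
  shows
    "(\<exists>R :: ((real^'n) \<times> (real^'n) \<times> (real^'n) \<times> (real^'n) \<times> (real^'n)) set.
        bij_betw (\<lambda>(P, V, \<mu>, l, \<nu>). P) R (boundary_demands Y_LL I_L) \<and>
        bij_betw (\<lambda>(P, V, \<mu>, l, \<nu>). V) R (boundary_operating_points Y_LL I_L) \<and>
        bij_betw (\<lambda>(P, V, \<mu>, l, \<nu>). \<mu>) R (mu_parameters Y_LL) \<and>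
        bij_betw (\<lambda>(P, V, \<mu>, l, \<nu>). l) R (lambda_parameters Y_LL I_L) \<and>
        bij_betw (\<lambda>(P, V, \<mu>, l, \<nu>). \<nu>) R N1_set \<and>
        (\<forall>(P, V, \<mu>, l, \<nu>) \<in> R.
           P = P_c Y_LL I_L V \<and>
           V = psi Y_LL I_L \<mu> \<and>
           V = psi Y_LL I_L (matrix_inv Y_LL *v \<nu>) \<and>
           V = phi Y_LL I_L l \<and>
           V = phi Y_LL I_L (chi Y_LL I_L \<nu>) \<and>
           \<mu> \<propto> diag l *v phi Y_LL I_L l \<and>
           diag l *v phi Y_LL I_L l \<propto> matrix_inv Y_LL *v \<nu> \<and>
           l \<propto> matrix_inv (diag (psi Y_LL I_L \<mu>)) *v \<mu> \<and>
           matrix_inv (diag (psi Y_LL I_L \<mu>)) *v \<mu> \<propto> chi Y_LL I_L \<nu> \<and>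
           \<nu> \<propto> Y_LL *v (diag l *v phi Y_LL I_L l) \<and>
           Y_LL *v (diag l *v phi Y_LL I_L l) \<propto> Y_LL *v \<mu>)) \<and>
     bij_betw (\<lambda>\<nu>. (1 / norm1 (chi Y_LL I_L \<nu>)) *\<^sub>R chi Y_LL I_L \<nu>)
       N1_set (lambda_parameters Y_LL I_L) \<and>
     frontier (feasible Y_LL I_L) \<inter> N_set =
       {P_c Y_LL I_L (psi Y_LL I_L (matrix_inv Y_LL *v \<nu>)) | \<nu>. \<nu> \<in> N1_set} \<and>
     {V \<in> frontier (D_set Y_LL I_L). 0 \<le> P_c Y_LL I_L V} =
       {psi Y_LL I_L (matrix_inv Y_LL *v \<nu>) | \<nu>. \<nu> \<in> N1_set}"
proof -
  interpret load_network Y_LL I_L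
    using kirchhoff_load_network assms by metis
  \<comment> \<open>The relation is the graph of the parametrization by \<open>\<nu>\<close>; each
    projection is bijective on it because its composition with \<open>?f\<close> is.\<close>
  let ?f = "\<lambda>\<nu>. (P_c Y_LL I_L (V_of \<nu>), V_of \<nu>, normalize1 (mu_of \<nu>), normalize1 (chi Y_LL I_L \<nu>), \<nu>)"
  have "bij_betw (\<lambda>(P, V, \<mu>, l, \<nu>). P) (?f ` N1_set) (boundary_demands Y_LL I_L)"
    "bij_betw (\<lambda>(P, V, \<mu>, l, \<nu>). V) (?f ` N1_set) (boundary_operating_points Y_LL I_L)"
    "bij_betw (\<lambda>(P, V, \<mu>, l, \<nu>). \<mu>) (?f ` N1_set) (mu_parameters Y_LL)"
    "bij_betw (\<lambda>(P, V, \<mu>, l, \<nu>). l) (?f ` N1_set) (lambda_parameters Y_LL I_L)"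
    "bij_betw (\<lambda>(P, V, \<mu>, l, \<nu>). \<nu>) (?f ` N1_set) N1_set"
    using bij_betw_boundary_demands bij_betw_boundary_operating_points bij_betw_mu_parameters
      bij_betw_lambda_parameters bij_betw_id[of "N1_set :: (real^'n) set"]
    by (auto simp: id_def intro!: bij_betw_image)
  moreover have "\<forall>(P, V, \<mu>, l, \<nu>) \<in> ?f ` N1_set.
           P = P_c Y_LL I_L V \<and>
           V = psi Y_LL I_L \<mu> \<and>
           V = psi Y_LL I_L (matrix_inv Y_LL *v \<nu>) \<and>
           V = phi Y_LL I_L l \<and>
           V = phi Y_LL I_L (chi Y_LL I_L \<nu>) \<and>
           \<mu> \<propto> diag l *v phi Y_LL I_L l \<and>
           diag l *v phi Y_LL I_L l \<propto> matrix_inv Y_LL *v \<nu> \<and>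
           l \<propto> matrix_inv (diag (psi Y_LL I_L \<mu>)) *v \<mu> \<and>
           matrix_inv (diag (psi Y_LL I_L \<mu>)) *v \<mu> \<propto> chi Y_LL I_L \<nu> \<and>
           \<nu> \<propto> Y_LL *v (diag l *v phi Y_LL I_L l) \<and>
           Y_LL *v (diag l *v phi Y_LL I_L l) \<propto> Y_LL *v \<mu>"
    (is "\<forall>(P, V, \<mu>, l, \<nu>) \<in> _. ?eqs P V \<mu> l \<nu>")
  proof
    fix t assume "t \<in> ?f ` N1_set"
    then obtain \<nu> where \<nu>: "\<nu> \<in> N1_set" "t = ?f \<nu>" by blast
    show "case t of (P, V, \<mu>, l, \<nu>) \<Rightarrow> ?eqs P V \<mu> l \<nu>"
      unfolding \<nu>(2) prod.case
      by (intro conjI refl correspondence_equations[OF \<nu>(1) refl refl refl])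
  qed
  moreover have "bij_betw (\<lambda>\<nu>. (1 / norm1 (chi Y_LL I_L \<nu>)) *\<^sub>R chi Y_LL I_L \<nu>)
      N1_set (lambda_parameters Y_LL I_L)"
    using bij_betw_lambda_parameters by (simp only: normalize1_def)
  moreover have "frontier (feasible Y_LL I_L) \<inter> N_set = {P_c Y_LL I_L (V_of \<nu>) | \<nu>. \<nu> \<in> N1_set}"
    using bij_betw_imp_surj_on[OF bij_betw_boundary_demands]
    by (simp only: boundary_demands_def Setcompr_eq_image)
  moreover have "{V \<in> frontier (D_set Y_LL I_L). 0 \<le> P_c Y_LL I_L V} = {V_of \<nu> | \<nu>. \<nu> \<in> N1_set}"
    using bij_betw_imp_surj_on[OF bij_betw_boundary_operating_points]
    by (simp only: operating_points_eq Setcompr_eq_image)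
  ultimately show ?thesis
    by - (rule conjI, rule exI[of _ "?f ` N1_set"], (intro conjI; assumption)+)
qed

end
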